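(* Suppose that assumptions (H1) and (H2) stated in the context hold, and let $p\in[1,+\infty]$. Endow the linear space $X$ from (H1) with the standard $L^p(G)$-norm $\|\cdot\|_p$. Then: (i) The initial boundary value problem $$(Lx)(t,z)=0\ \text{ for } (t,z)\in(0,+\infty)\times G,\quad x(0,z)=x_0(z)\ \text{ for } z\in G,\quad x(t,z)=u(t,z)\ \text{ for } (t,z)\in\mathbb{R}_+\times\partial G$$ gives rise to the monotone control system $\Sigma=(X,\mathcal{U},\phi)$, where $\phi$ is the solution map of this problem, that is, $\phi(t,x_0,u)=x[t]=x(t,\cdot)$ for $t\ge 0$, $x_0\in X$, $u\in\mathcal{U}(x_0)$. (ii) If additionally (H3) (stated in the context) holds, then, with $\mathcal{U}_c:=\{u\in\mathcal{U}:\exists k\in\mathbb{R}:\ u(t,z)=k\ \forall(t,z)\in\mathbb{R}_+\times\partial G\}$, the following two conditions hold with linear functions $\rho,\eta,\xi\in\mathcal{K}_\infty$: (a) for any $x_-,x,x_+\in X$ satisfying $x_-\le x\le x_+$ it holds that $\|x\|_p\le\rho(\|x_-\|_p+\|x_+\|_p)$; (b) for every $x\in X$, $u\in\mathcal{U}(x)$ and $\varepsilon>0$ there exist $x_-,x_+\in X$ and $u_-\in\mathcal{U}(x_-)\cap\mathcal{U}_c$, $u_+\in\mathcal{U}(x_+)\cap\mathcal{U}_c$ satisfying $x_-\le x\le x_+$, $u_-\le u\le u_+$, $\max(\|u_-\|_{\mathcal{U}},\|u_+\|_{\mathcal{U}})\le\eta(\|u\|_{\mathcal{U}}+\varepsilon)$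 and $\max(\|x_-\|_p,\|x_+\|_p)\le\xi(\|x\|_p+\|u\|_{\mathcal{U}}+\varepsilon)$.
   Context: Setting. $\mathbb{R}_+=[0,\infty)$; $G\subset\mathbb{R}^n$ is an open bounded region; $CL$ is the class of functions $x\in C^0(\mathbb{R}_+\times\overline{G})\cap C^{1,2}((0,+\infty)\times G)$, where $C^{1,2}$ means continuously differentiable in $t$ with continuous second derivatives in $z$. For $x\in CL$, $$(Lx)(t,z):=\frac{\partial x}{\partial t}(t,z)-\sum_{i,j=1}^n a_{i,j}(z)\frac{\partial^2x}{\partial z_i\partial z_j}(t,z)-f\big(z,x(t,z),\nabla x(t,z)\big),$$ with $a_{i,j}\in C^0(\overline{G})$ and $f\in C^0(\overline{G}\times\mathbb{R}\times\mathbb{R}^n)$. $L$ is assumed uniformly parabolic: there is $K>0$ with $\sum_{i,j=1}^n a_{i,j}(z)\xi_i\xi_j\ge K|\xi|^2$ for all $\xi\in\mathbb{R}^n$, $z\in\overline{G}$. Inputs. $U=C^0(\partial G)$ with the sup-norm, $\mathcal{U}:=\{u\in C^0(\mathbb{R}_+;U): u \text{ is bounded}\}$ with $\|u\|_{\mathcal{U}}=\sup_{t\ge0,\,z\in\partial G}|u(t,z)|$, ordered by $u\le v$ iff $u(t,z)\le v(t,z)$ for all $(t,z)\in\mathbb{R}_+\times\partial G$. $X$ is ordered by $x\le y$ iff $x(z)\le y(z)$ for all $z\in\overline{G}$. $\|x\|_p=(\int_G|x(z)|^pdz)^{1/p}$ for $p<\infty$, and $\|x\|_\infty$ is the essential supremum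 of $|x|$ over $G$. $\mathcal{K}_\infty$ is the set of continuous, strictly increasing, unbounded functions $\gamma:\mathbb{R}_+\to\mathbb{R}_+$ with $\gamma(0)=0$. (H1) There is a linear space $X\subseteq C^0(\overline{G})$ containing all constant functions, and for each $x_0\in X$ a set of inputs $\mathcal{U}(x_0)\subseteq\{v\in\mathcal{U}: v(0,z)=x_0(z)\text{ for }z\in\partial G\}$, such that: if $x_0\in X$ is constant on $\partial G$, then $\mathcal{U}(x_0)$ contains the constant in time and space input $v$ given by $v(t,z)=x_0(z)$ for $z\in\partial G$, $t\ge0$; and for every $x_0\in X$, $u\in\mathcal{U}(x_0)$ there exists a solution $x\in CL$ of the initial boundary value problem stated in part (i) of the claim for which $x[t]:=x(t,\cdot)\in X$ for all $t\ge0$. (H2) For every bounded set $W\subset\mathbb{R}$ there is $k>0$ such that $f(z,w_1,\xi)-f(z,w_2,\xi)<k(w_1-w_2)$ for all $w_1,w_2\in W$ with $w_1>w_2$, $z\in G$, $\xi\in\mathbb{R}^n$. Moreover, the function $(z,w,\xi)\mapsto f(z,w,\xi)$ on $\overline{G}\times\mathbb{R}\times\mathbb{R}^n$ is continuously differentiable with respect to $w\in\mathbb{R}$ and $\xi\in\mathbb{R}^n$. (H3) For every $\delta>0$, $a\in\mathbb{R}$, $x\in X$ there is a continuous function $k:\overline{G}\to[0,1]$ with $k(z)=1$ for $z\in\partial G$, $k(z)=0$ for all $z\in G$ whose Euclidean distance to $\partial G$ is at least $\delta$, and such that the function $z\mapsto(1-k(z))x(z)+a\,k(z)$ belongs to $X$.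 Control system: a triple $(X,\mathcal{U},\phi)$ with $X$ a normed linear space, $\mathcal{U}$ a normed linear space of functions $\mathbb{R}_+\to U$ (with $U$ a nonempty subset of a normed linear space) closed under time shifts $u\mapsto u(\cdot+\tau)$, $\tau\ge0$, a family of nonempty sets $\mathcal{U}(x)\subset\mathcal{U}$ of admissible inputs for $x\in X$, and a transition map $\phi$ such that: $\phi(t,x,u)\in X$ is well defined for all $x\in X$, $u\in\mathcal{U}(x)$, $t\ge0$; $\phi(0,x,u)=x$ for all $x\in X$, $u\in\mathcal{U}(x)$; $\phi(t,x,u)=\phi(t,x,\tilde u)$ whenever $u,\tilde u\in\mathcal{U}(x)$ coincide on $[0,t]$; and for all $t,h\ge0$, $x\in X$, $u\in\mathcal{U}(x)$ one has $u(t+\cdot)\in\mathcal{U}(\phi(t,x,u))$ and $\phi(h,\phi(t,x,u),u(t+\cdot))=\phi(t+h,x,u)$. When $X$ and $\mathcal{U}$ are ordered normed linear spaces, it is called monotone if $\phi(t,x_1,u_1)\le\phi(t,x_2,u_2)$ for all $t\ge0$, all $x_1\le x_2$ in $X$ and all $u_1\in\mathcal{U}(x_1)$, $u_2\in\mathcal{U}(x_2)$ with $u_1\le u_2$.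
   Formalization: For the control-system claim in (i) it is additionally assumed that every U(x_0) is nonempty and that u(t+·) is in U(x[t]) for every solution x and t≥0; (H1) does not imply this, and the definition of a control system requires it. *)

theory Defs
  imports
    "HOL-Analysis.Analysis"
    "HOL-Library.Function_Algebras"
    "HOL-Probability.Essential_Supremum"
begin

text \<open>
  Convention: a function whose domain is a set \<open>S\<close> (for instance an element of \<open>C\<^sup>0(S)\<close>, or an input
  defined for times \<open>t \<ge> 0\<close>) is represented by the total function that extends it by zero.
  Equality of representatives is then equality of functions on \<open>S\<close>, and the pointwise vector space
  structure on total functions induces the one on functions on \<open>S\<close>.
\<close>

instantiation "fun" :: (type, real_vector) real_vector
begin

definition scaleR_fun :: "real \<Rightarrow> ('a \<Rightarrow> 'b) \<Rightarrow> 'a \<Rightarrow> 'b"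
  where "scaleR_fun c f = (\<lambda>x. c *\<^sub>R f x)"

instance
  by standard (simp_all add: scaleR_fun_def fun_eq_iff scaleR_add_right scaleR_add_left)

end

definition restr0 :: "'a set \<Rightarrow> ('a \<Rightarrow> real) \<Rightarrow> 'a \<Rightarrow> real"
  where "restr0 S w = (\<lambda>z. if z \<in> S then w z else 0)"

definition C0 :: "'a::topological_space set \<Rightarrow> ('a \<Rightarrow> real) set"
  where "C0 S = {w. continuous_on S w \<and> (\<forall>z. z \<notin> S \<longrightarrow> w z = 0)}"

definition sup_norm :: "'a set \<Rightarrow> ('a \<Rightarrow> real) \<Rightarrow> real"
  where "sup_norm S w = (SUP z\<in>S. \<bar>w z\<bar>)"


section \<open>Control systems\<close>

locale normed_linear_space =
  fixes V :: "'v::real_vector set" and nrm :: "'v \<Rightarrow> real"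
  assumes subspace: "subspace V"
    and nrm_eq_0: "v \<in> V \<Longrightarrow> nrm v = 0 \<longleftrightarrow> v = 0"
    and nrm_triangle: "v \<in> V \<Longrightarrow> w \<in> V \<Longrightarrow> nrm (v + w) \<le> nrm v + nrm w"
    and nrm_scaleR: "v \<in> V \<Longrightarrow> nrm (c *\<^sub>R v) = \<bar>c\<bar> * nrm v"

locale ordered_normed_linear_space = normed_linear_space V nrm
  for V :: "'v::real_vector set" and nrm :: "'v \<Rightarrow> real" +
  fixes le :: "'v \<Rightarrow> 'v \<Rightarrow> bool"
  assumes le_refl: "v \<in> V \<Longrightarrow> le v v"
    and le_antisym: "v \<in> V \<Longrightarrow> w \<in> V \<Longrightarrow> le v w \<Longrightarrow> le w v \<Longrightarrow> v = w"
    and le_trans: "u \<in> V \<Longrightarrow> v \<in> V \<Longrightarrow> w \<in> V \<Longrightarrow> le u v \<Longrightarrow> le v w \<Longrightarrow> le u w"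
    and le_add: "u \<in> V \<Longrightarrow> v \<in> V \<Longrightarrow> w \<in> V \<Longrightarrow> le v w \<Longrightarrow> le (v + u) (w + u)"
    and le_scaleR: "v \<in> V \<Longrightarrow> w \<in> V \<Longrightarrow> 0 \<le> c \<Longrightarrow> le v w \<Longrightarrow> le (c *\<^sub>R v) (c *\<^sub>R w)"

definition time_shift :: "real \<Rightarrow> (real \<Rightarrow> 'v::zero) \<Rightarrow> real \<Rightarrow> 'v"
  where "time_shift \<tau> u = (\<lambda>t. if 0 \<le> t then u (t + \<tau>) else 0)"

text \<open>
  \<open>X\<close> is the state space, \<open>V\<close> the normed space of which the set of input values \<open>U\<close> is a subset,
  \<open>UU\<close> the space of all inputs and \<open>Uad x\<close> the set of inputs admissible for the initial state \<open>x\<close>.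
\<close>

locale control_system =
  X: normed_linear_space X nX + V: normed_linear_space V nV + UU: normed_linear_space UU nUU
  for X :: "'x::real_vector set" and nX :: "'x \<Rightarrow> real"
    and V :: "'v::real_vector set" and nV :: "'v \<Rightarrow> real"
    and UU :: "(real \<Rightarrow> 'v) set" and nUU :: "(real \<Rightarrow> 'v) \<Rightarrow> real" +
  fixes U :: "'v set"
    and Uad :: "'x \<Rightarrow> (real \<Rightarrow> 'v) set"
    and \<phi> :: "real \<Rightarrow> 'x \<Rightarrow> (real \<Rightarrow> 'v) \<Rightarrow> 'x"
  assumes U_subset: "U \<subseteq> V" and U_nonempty: "U \<noteq> {}"
    and input_values: "u \<in> UU \<Longrightarrow> 0 \<le> t \<Longrightarrow> u t \<in> U"
    and input_zero: "u \<in> UU \<Longrightarrow> t < 0 \<Longrightarrow> u t = 0"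
    and shift_closed: "u \<in> UU \<Longrightarrow> 0 \<le> \<tau> \<Longrightarrow> time_shift \<tau> u \<in> UU"
    and Uad_nonempty: "x \<in> X \<Longrightarrow> Uad x \<noteq> {}"
    and Uad_subset: "x \<in> X \<Longrightarrow> Uad x \<subseteq> UU"
    and well_defined: "x \<in> X \<Longrightarrow> u \<in> Uad x \<Longrightarrow> 0 \<le> t \<Longrightarrow> \<phi> t x u \<in> X"
    and identity: "x \<in> X \<Longrightarrow> u \<in> Uad x \<Longrightarrow> \<phi> 0 x u = x"
    and causality: "x \<in> X \<Longrightarrow> u \<in> Uad x \<Longrightarrow> u' \<in> Uad x \<Longrightarrow> 0 \<le> t \<Longrightarrow>
          (\<forall>s\<in>{0..t}. u s = u' s) \<Longrightarrow> \<phi> t x u = \<phi> t x u'"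
    and shift_admissible: "x \<in> X \<Longrightarrow> u \<in> Uad x \<Longrightarrow> 0 \<le> t \<Longrightarrow> time_shift t u \<in> Uad (\<phi> t x u)"
    and cocycle: "x \<in> X \<Longrightarrow> u \<in> Uad x \<Longrightarrow> 0 \<le> t \<Longrightarrow> 0 \<le> h \<Longrightarrow>
          \<phi> h (\<phi> t x u) (time_shift t u) = \<phi> (t + h) x u"

locale monotone_control_system =
  control_system X nX V nV UU nUU U Uad \<phi> +
  X: ordered_normed_linear_space X nX leX + UU: ordered_normed_linear_space UU nUU leU
  for X :: "'x::real_vector set" and nX and leX
    and V :: "'v::real_vector set" and nV
    and UU :: "(real \<Rightarrow> 'v) set" and nUU and leU
    and U and Uad and \<phi> +
  assumes monotone: "x\<^sub>1 \<in> X \<Longrightarrow> x\<^sub>2 \<in> X \<Longrightarrow> u\<^sub>1 \<in> Uad x\<^sub>1 \<Longrightarrow> u\<^sub>2 \<in> Uad x\<^sub>2 \<Longrightarrow>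
          leX x\<^sub>1 x\<^sub>2 \<Longrightarrow> leU u\<^sub>1 u\<^sub>2 \<Longrightarrow> 0 \<le> t \<Longrightarrow> leX (\<phi> t x\<^sub>1 u\<^sub>1) (\<phi> t x\<^sub>2 u\<^sub>2)"

definition class_Kinf :: "(real \<Rightarrow> real) \<Rightarrow> bool"
  where "class_Kinf \<gamma> \<longleftrightarrow> continuous_on {0..} \<gamma> \<and> strict_mono_on {0..} \<gamma> \<and> \<gamma> 0 = 0 \<and>
           (\<forall>M. \<exists>r\<ge>0. \<gamma> r > M)"


section \<open>Spaces and orders for the boundary value problem\<close>

definition Lp_norm :: "(real^'n) set \<Rightarrow> ereal \<Rightarrow> (real^'n \<Rightarrow> real) \<Rightarrow> real"
  where "Lp_norm G p x =
    (if p = \<infinity> then real_of_ereal (esssup (lebesgue_on G) (\<lambda>z. ereal \<bar>x z\<bar>))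
     else (\<integral>z. \<bar>x z\<bar> powr real_of_ereal p \<partial>lebesgue_on G) powr (1 / real_of_ereal p))"

text \<open>Bounded functions in \<open>C\<^sup>0(\<real>\<^sub>+; U)\<close>, where \<open>U = C\<^sup>0(\<partial>G)\<close> carries the sup-norm.\<close>

definition input_space :: "(real^'n) set \<Rightarrow> (real \<Rightarrow> real^'n \<Rightarrow> real) set"
  where "input_space G = {u.
      (\<forall>t\<ge>0. u t \<in> C0 (frontier G)) \<and> (\<forall>t<0. u t = 0) \<and>
      (\<forall>t\<ge>0. ((\<lambda>s. sup_norm (frontier G) (u s - u t)) \<longlongrightarrow> 0) (at t within {0..})) \<and>
      (\<exists>M. \<forall>t\<ge>0. sup_norm (frontier G) (u t) \<le> M)}"

definition input_norm :: "(real^'n) set \<Rightarrow> (real \<Rightarrow> real^'n \<Rightarrow> real) \<Rightarrow> real"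
  where "input_norm G u = (SUP (t, z) \<in> {0..} \<times> frontier G. \<bar>u t z\<bar>)"

definition const_inputs :: "(real^'n) set \<Rightarrow> (real \<Rightarrow> real^'n \<Rightarrow> real) set"
  where "const_inputs G = {u \<in> input_space G. \<exists>k. \<forall>t\<ge>0. \<forall>z\<in>frontier G. u t z = k}"

definition state_le :: "(real^'n) set \<Rightarrow> (real^'n \<Rightarrow> real) \<Rightarrow> (real^'n \<Rightarrow> real) \<Rightarrow> bool"
  where "state_le G x y \<longleftrightarrow> (\<forall>z\<in>closure G. x z \<le> y z)"

definition input_le ::
    "(real^'n) set \<Rightarrow> (real \<Rightarrow> real^'n \<Rightarrow> real) \<Rightarrow> (real \<Rightarrow> real^'n \<Rightarrow> real) \<Rightarrow> bool"
  where "input_le G u v \<longleftrightarrow> (\<forall>t\<ge>0. \<forall>z\<in>frontier G. u t z \<le> v t z)"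


section \<open>The parabolic operator\<close>

definition partial_z :: "'n::finite \<Rightarrow> (real^'n \<Rightarrow> real) \<Rightarrow> real^'n \<Rightarrow> real"
  where "partial_z i w z = deriv (\<lambda>h. w (z + h *\<^sub>R axis i 1)) 0"

definition has_partial_z :: "'n::finite \<Rightarrow> (real^'n \<Rightarrow> real) \<Rightarrow> real^'n \<Rightarrow> bool"
  where "has_partial_z i w z \<longleftrightarrow> (\<lambda>h::real. w (z + h *\<^sub>R axis i 1)) differentiable (at 0)"

definition partial_t :: "(real \<Rightarrow> real^'n \<Rightarrow> real) \<Rightarrow> real \<Rightarrow> real^'n \<Rightarrow> real"
  where "partial_t x t z = deriv (\<lambda>s. x s z) t"

definition grad_z :: "(real^'n \<Rightarrow> real) \<Rightarrow> real^'n \<Rightarrow> real^'n"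
  where "grad_z w z = (\<chi> i. partial_z i w z)"

definition C12 :: "(real^'n) set \<Rightarrow> (real \<Rightarrow> real^'n \<Rightarrow> real) \<Rightarrow> bool"
  where "C12 G x \<longleftrightarrow>
    (\<forall>t>0. \<forall>z\<in>G. (\<lambda>s. x s z) differentiable (at t) \<and>
       (\<forall>i. has_partial_z i (x t) z) \<and> (\<forall>i j. has_partial_z i (partial_z j (x t)) z)) \<and>
    continuous_on ({0<..} \<times> G) (\<lambda>(t, z). x t z) \<and>
    continuous_on ({0<..} \<times> G) (\<lambda>(t, z). partial_t x t z) \<and>
    (\<forall>i. continuous_on ({0<..} \<times> G) (\<lambda>(t, z). partial_z i (x t) z)) \<and>
    (\<forall>i j. continuous_on ({0<..} \<times> G) (\<lambda>(t, z). partial_z i (partial_z j (x t)) z))"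

definition CL :: "(real^'n) set \<Rightarrow> (real \<Rightarrow> real^'n \<Rightarrow> real) set"
  where "CL G = {x. continuous_on ({0..} \<times> closure G) (\<lambda>(t, z). x t z) \<and>
                    (\<forall>t z. \<not> (0 \<le> t \<and> z \<in> closure G) \<longrightarrow> x t z = 0) \<and> C12 G x}"

definition L_op :: "('n::finite \<Rightarrow> 'n \<Rightarrow> real^'n \<Rightarrow> real) \<Rightarrow> (real^'n \<Rightarrow> real \<Rightarrow> real^'n \<Rightarrow> real) \<Rightarrow>
    (real \<Rightarrow> real^'n \<Rightarrow> real) \<Rightarrow> real \<Rightarrow> real^'n \<Rightarrow> real"
  where "L_op a f x t z = partial_t x t z
           - (\<Sum>i\<in>UNIV. \<Sum>j\<in>UNIV. a i j z * partial_z i (partial_z j (x t)) z)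
           - f z (x t z) (grad_z (x t) z)"

definition uniformly_parabolic :: "(real^'n) set \<Rightarrow> ('n::finite \<Rightarrow> 'n \<Rightarrow> real^'n \<Rightarrow> real) \<Rightarrow> bool"
  where "uniformly_parabolic G a \<longleftrightarrow> (\<exists>K>0. \<forall>z\<in>closure G. \<forall>\<xi>.
           (\<Sum>i\<in>UNIV. \<Sum>j\<in>UNIV. a i j z * \<xi> $ i * \<xi> $ j) \<ge> K * (norm \<xi>)\<^sup>2)"

definition ibvp_solution :: "(real^'n) set \<Rightarrow> ('n::finite \<Rightarrow> 'n \<Rightarrow> real^'n \<Rightarrow> real) \<Rightarrow>
    (real^'n \<Rightarrow> real \<Rightarrow> real^'n \<Rightarrow> real) \<Rightarrow> (real^'n \<Rightarrow> real) \<Rightarrow> (real \<Rightarrow> real^'n \<Rightarrow> real) \<Rightarrow>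
    (real \<Rightarrow> real^'n \<Rightarrow> real) \<Rightarrow> bool"
  where "ibvp_solution G a f x0 u x \<longleftrightarrow> x \<in> CL G \<and>
           (\<forall>t>0. \<forall>z\<in>G. L_op a f x t z = 0) \<and>
           (\<forall>z\<in>G. x 0 z = x0 z) \<and>
           (\<forall>t\<ge>0. \<forall>z\<in>frontier G. x t z = u t z)"

definition solution_map :: "(real^'n) set \<Rightarrow> ('n::finite \<Rightarrow> 'n \<Rightarrow> real^'n \<Rightarrow> real) \<Rightarrow>
    (real^'n \<Rightarrow> real \<Rightarrow> real^'n \<Rightarrow> real) \<Rightarrow>
    real \<Rightarrow> (real^'n \<Rightarrow> real) \<Rightarrow> (real \<Rightarrow> real^'n \<Rightarrow> real) \<Rightarrow> (real^'n \<Rightarrow> real)"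
  where "solution_map G a f t x0 u = (THE x. ibvp_solution G a f x0 u x) t"


section \<open>Assumptions\<close>

definition H1 :: "(real^'n) set \<Rightarrow> ('n::finite \<Rightarrow> 'n \<Rightarrow> real^'n \<Rightarrow> real) \<Rightarrow>
    (real^'n \<Rightarrow> real \<Rightarrow> real^'n \<Rightarrow> real) \<Rightarrow> (real^'n \<Rightarrow> real) set \<Rightarrow>
    ((real^'n \<Rightarrow> real) \<Rightarrow> (real \<Rightarrow> real^'n \<Rightarrow> real) set) \<Rightarrow> bool"
  where "H1 G a f X Uad \<longleftrightarrow>
    subspace X \<and> X \<subseteq> C0 (closure G) \<and> (\<forall>c. restr0 (closure G) (\<lambda>_. c) \<in> X) \<and>
    (\<forall>x0\<in>X. Uad x0 \<subseteq> {v \<in> input_space G. \<forall>z\<in>frontier G. v 0 z = x0 z}) \<and>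
    (\<forall>x0\<in>X. (\<exists>c. \<forall>z\<in>frontier G. x0 z = c) \<longrightarrow>
       (\<lambda>t. if 0 \<le> t then restr0 (frontier G) x0 else 0) \<in> Uad x0) \<and>
    (\<forall>x0\<in>X. \<forall>u\<in>Uad x0. \<exists>x\<in>CL G. ibvp_solution G a f x0 u x \<and> (\<forall>t\<ge>0. x t \<in> X))"

definition H2 :: "(real^'n) set \<Rightarrow> (real^'n \<Rightarrow> real \<Rightarrow> real^'n \<Rightarrow> real) \<Rightarrow> bool"
  where "H2 G f \<longleftrightarrow>
    (\<forall>W. bounded W \<longrightarrow> (\<exists>k>0. \<forall>w\<^sub>1\<in>W. \<forall>w\<^sub>2\<in>W. w\<^sub>1 > w\<^sub>2 \<longrightarrow>
       (\<forall>z\<in>G. \<forall>\<xi>. f z w\<^sub>1 \<xi> - f z w\<^sub>2 \<xi> < k * (w\<^sub>1 - w\<^sub>2)))) \<and>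
    (\<exists>fw f\<xi>.
       (\<forall>z\<in>closure G. \<forall>w \<xi>.
          ((\<lambda>v. f z v \<xi>) has_real_derivative fw z w \<xi>) (at w) \<and>
          (GDERIV (\<lambda>\<zeta>. f z w \<zeta>) \<xi> :> f\<xi> z w \<xi>)) \<and>
       continuous_on (closure G \<times> UNIV \<times> UNIV) (\<lambda>(z, w, \<xi>). fw z w \<xi> :: real) \<and>
       continuous_on (closure G \<times> UNIV \<times> UNIV) (\<lambda>(z, w, \<xi>). f\<xi> z w \<xi> :: real^'n))"

definition H3 :: "(real^'n) set \<Rightarrow> (real^'n \<Rightarrow> real) set \<Rightarrow> bool"
  where "H3 G X \<longleftrightarrow> (\<forall>\<delta>>0. \<forall>a. \<forall>x\<in>X. \<exists>k.
    continuous_on (closure G) k \<and> k ` closure G \<subseteq> {0..1} \<and>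
    (\<forall>z\<in>frontier G. k z = 1) \<and> (\<forall>z\<in>G. infdist z (frontier G) \<ge> \<delta> \<longrightarrow> k z = 0) \<and>
    restr0 (closure G) (\<lambda>z. (1 - k z) * x z + a * k z) \<in> X)"

text \<open>
  Those axioms of a control system that concern the family \<open>Uad\<close> of admissible inputs alone: the
  sets are nonempty, and the rest of an admissible input is admissible for the state reached.
  They cannot be derived from \<open>H1\<close>, which constrains \<open>Uad x0\<close> for each \<open>x0\<close> separately and allows
  it to be empty if \<open>x0\<close> is not constant on the boundary.
\<close>

definition admissible_family :: "(real^'n) set \<Rightarrow> ('n::finite \<Rightarrow> 'n \<Rightarrow> real^'n \<Rightarrow> real) \<Rightarrow>
    (real^'n \<Rightarrow> real \<Rightarrow> real^'n \<Rightarrow> real) \<Rightarrow> (real^'n \<Rightarrow> real) set \<Rightarrow>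
    ((real^'n \<Rightarrow> real) \<Rightarrow> (real \<Rightarrow> real^'n \<Rightarrow> real) set) \<Rightarrow> bool"
  where "admissible_family G a f X Uad \<longleftrightarrow>
    (\<forall>x0\<in>X. Uad x0 \<noteq> {}) \<and>
    (\<forall>x0\<in>X. \<forall>u\<in>Uad x0. \<forall>x. ibvp_solution G a f x0 u x \<longrightarrow>
       (\<forall>t\<ge>0. time_shift t u \<in> Uad (x t)))"

end

theory Submission
  imports Defs
begin

text \<open>
  Everything about solutions rests on one comparison principle, \<open>parabolic_comparison\<close>: initial
  and boundary values that are ordered produce ordered solutions. Suppose that \<open>x - y\<close> is positive
  somewhere on a cylinder and look at a positive maximum of \<open>exp (- k * t) * (x - y)\<close>. There the
  spatial gradients of \<open>x\<close> and \<open>y\<close> agree, the Hessian of \<open>x - y\<close> is negative semidefinite, and the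
  time derivative of the weighted difference is nonnegative. Ellipticity makes the second order terms
  ordered, so the two equations reduce the time derivative of \<open>x - y\<close> to a difference of values of
  \<open>f\<close> at equal gradients, which \<open>H2\<close> makes smaller than \<open>k * (x - y)\<close>: a contradiction.
  The calculus behind this is the second derivative test for functions with continuous second partial
  derivatives (\<open>second_order_condition_at_max\<close>), the symmetry of these derivatives
  (\<open>mixed_partials_commute\<close>), and the fact that the pairing of a positive definite matrix with a
  symmetric negative semidefinite one is nonpositive (\<open>trace_product_nonpos\<close>).

  Comparison yields uniqueness, hence a well-defined solution map; used on a finite time interval it
  yields causality (\<open>solution_unique\<close>). The cocycle property is uniqueness applied to the shifted solution
  (\<open>ibvp_solution_time_shift\<close>), and monotonicity is comparison itself. The state space is normed by
  the \<open>L\<^sup>p\<close>-norm because of Minkowski's inequality and because a continuous function that vanishes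
  almost everywhere on an open set vanishes on its closure (\<open>normed_linear_space_Lp\<close>).

  For the second part, \<open>x\<^sub>m \<le> x \<le> x\<^sub>p\<close> implies \<open>\<bar>x\<bar> \<le> \<bar>x\<^sub>m\<bar> + \<bar>x\<^sub>p\<bar>\<close>, so
  condition (a) holds with the identity. For (b), the cutoff functions of \<open>H3\<close> deform \<open>x\<close>, in a
  thin layer along the boundary, into the constants \<open>\<parallel>u\<parallel> + \<epsilon>\<close> and \<open>- (\<parallel>u\<parallel> + \<epsilon>)\<close>. In that layer
  \<open>\<bar>x\<bar> \<le> \<parallel>u\<parallel> + \<epsilon>\<close> since \<open>x\<close> is uniformly continuous and equals \<open>u 0\<close> on the boundary, so
  the deformed states lie above and below \<open>x\<close>, and they exceed \<open>\<bar>x\<bar>\<close> in modulus by at most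
  \<open>\<parallel>u\<parallel> + \<epsilon>\<close> (\<open>constant_input_bracket\<close>).
\<close>

section \<open>Pairing a positive definite with a negative semidefinite form\<close>

lemma quadratic_form_insert:
  fixes A :: "'i \<Rightarrow> 'i \<Rightarrow> real"
  assumes "finite S" "k \<notin> S"
  shows "(\<Sum>i\<in>insert k S. \<Sum>j\<in>insert k S. A i j * B i j) =
     A k k * B k k + (\<Sum>i\<in>S. A i k * B i k) + (\<Sum>i\<in>S. A k i * B k i) + (\<Sum>i\<in>S. \<Sum>j\<in>S. A i j * B i j)"
  using assms by (simp add: sum.distrib algebra_simps)

text \<open>
  Schur complements replace diagonalisation: subtracting the rank one form \<open>A i k * A j k / A k k\<close>
  from \<open>A\<close> leaves a positive definite form on the remaining indices, and pairing that rank one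
  form with \<open>H\<close> is, up to a positive factor, the quadratic form of \<open>H\<close> at the \<open>k\<close>-th column of \<open>A\<close>.
\<close>

lemma trace_product_nonpos_symmetric:
  fixes A H :: "'i \<Rightarrow> 'i \<Rightarrow> real"
  assumes "finite S"
    and "\<And>i j. A i j = A j i"
    and "\<And>v. \<exists>i\<in>S. v i \<noteq> 0 \<Longrightarrow> (\<Sum>i\<in>S. \<Sum>j\<in>S. A i j * (v i * v j)) > 0"
    and "\<And>v. (\<Sum>i\<in>S. \<Sum>j\<in>S. H i j * (v i * v j)) \<le> 0"
  shows "(\<Sum>i\<in>S. \<Sum>j\<in>S. A i j * H i j) \<le> 0"
  using assms
proof (induction S arbitrary: A rule: finite_induct)
  case empty
  then show ?case by simp
next
  case (insert k S)
  note sym = insert.prems(1) and pos = insert.prems(2) and neg = insert.prems(3)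
  define c where "c = A k k"
  have c: "c > 0"
  proof -
    define e where "e i = (if i = k then 1 else 0 :: real)" for i
    have "0 < (\<Sum>i\<in>insert k S. \<Sum>j\<in>insert k S. A i j * (e i * e j))"
      by (rule pos) (simp add: e_def)
    also have "\<dots> = A k k"
    proof -
      have "e i = 0" if "i \<in> S" for i using that insert.hyps by (auto simp: e_def)
      then show ?thesis using insert.hyps by (subst quadratic_form_insert) (auto simp: e_def)
    qed
    finally show ?thesis by (simp add: c_def)
  qed
  define B where "B i j = A i j - A i k * A j k / c" for i j
  have QB: "(\<Sum>i\<in>S. \<Sum>j\<in>S. B i j * Z i j) =
      (\<Sum>i\<in>S. \<Sum>j\<in>S. A i j * Z i j) - (\<Sum>i\<in>S. \<Sum>j\<in>S. Z i j * (A i k * A j k)) / c" for Z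
  proof -
    have "B i j * Z i j = A i j * Z i j - Z i j * (A i k * A j k) / c" for i j
      by (simp add: B_def left_diff_distrib)
    then show ?thesis by (simp add: sum_subtractf sum_divide_distrib)
  qed
  have "(\<Sum>i\<in>S. \<Sum>j\<in>S. B i j * H i j) \<le> 0"
  proof (rule insert.IH)
    show "B i j = B j i" for i j
      using sym[of i j] by (simp add: B_def)
    show "(\<Sum>i\<in>S. \<Sum>j\<in>S. B i j * (v i * v j)) > 0" if "\<exists>i\<in>S. v i \<noteq> 0" for v
    proof -
      define d where "d = (\<Sum>i\<in>S. A i k * v i)"
      \<comment> \<open>this value at k minimises the quadratic form of A over all extensions of v\<close>
      define w where "w = v(k := - d / c)"
      have wS: "w i = v i" if "i \<in> S" for i
        using that insert.hyps by (auto simp: w_def)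
      have "(\<Sum>i\<in>insert k S. \<Sum>j\<in>insert k S. A i j * (w i * w j)) > 0"
        by (rule pos) (use that insert.hyps in \<open>auto simp: w_def\<close>)
      moreover have "(\<Sum>i\<in>S. A i k * (w i * w k)) = - (d * d / c)"
      proof -
        have "(\<Sum>i\<in>S. A i k * (w i * w k)) = (\<Sum>i\<in>S. A i k * v i) * (- d / c)"
          unfolding sum_distrib_right by (rule sum.cong) (simp_all add: wS, simp add: w_def)
        then show ?thesis by (simp flip: d_def)
      qed
      moreover have "(\<Sum>i\<in>S. A k i * (w k * w i)) = (\<Sum>i\<in>S. A i k * (w i * w k))"
        by (rule sum.cong[OF refl]) (metis sym mult.commute)
      moreover have "A k k * (w k * w k) = d * d / c"
        using c by (simp add: w_def flip: c_def)
      moreover have "(\<Sum>i\<in>S. \<Sum>j\<in>S. A i j * (w i * w j)) = (\<Sum>i\<in>S. \<Sum>j\<in>S. A i j * (v i * v j))"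
        by (intro sum.cong) (auto simp: wS)
      moreover have "(\<Sum>i\<in>S. \<Sum>j\<in>S. (v i * v j) * (A i k * A j k)) = d * d"
        by (simp add: d_def sum_product mult_ac)
      moreover note quadratic_form_insert[OF insert.hyps, of A "\<lambda>i j. w i * w j"]
        QB[of "\<lambda>i j. v i * v j"]
      ultimately show ?thesis by simp
    qed
    show "(\<Sum>i\<in>S. \<Sum>j\<in>S. H i j * (v i * v j)) \<le> 0" for v
    proof -
      define w where "w = v(k := 0)"
      have wS: "w i = v i" if "i \<in> S" for i
        using that insert.hyps by (auto simp: w_def)
      have "(\<Sum>i\<in>S. \<Sum>j\<in>S. H i j * (v i * v j)) = (\<Sum>i\<in>S. \<Sum>j\<in>S. H i j * (w i * w j))"
        by (intro sum.cong) (auto simp: wS)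
      also have "\<dots> = (\<Sum>i\<in>insert k S. \<Sum>j\<in>insert k S. H i j * (w i * w j))"
        using insert.hyps by (subst quadratic_form_insert) (auto simp: w_def)
      finally show ?thesis using neg[of w] by simp
    qed
  qed
  moreover have "(\<Sum>i\<in>insert k S. \<Sum>j\<in>insert k S. H i j * (A i k * A j k)) / c \<le> 0"
    using neg[of "\<lambda>i. A i k"] c by (simp add: divide_le_0_iff)
  moreover have "(\<Sum>i\<in>insert k S. \<Sum>j\<in>insert k S. H i j * (A i k * A j k)) / c =
      A k k * H k k + (\<Sum>i\<in>S. A i k * H i k) + (\<Sum>i\<in>S. A k i * H k i)
       + (\<Sum>i\<in>S. \<Sum>j\<in>S. H i j * (A i k * A j k)) / c"
  proof -
    have 1: "(\<Sum>i\<in>S. H i k * (A i k * A k k)) = c * (\<Sum>i\<in>S. A i k * H i k)"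
      unfolding sum_distrib_left c_def by (rule sum.cong) (simp_all add: mult_ac)
    have 2: "(\<Sum>i\<in>S. H k i * (A k k * A i k)) = c * (\<Sum>i\<in>S. A k i * H k i)"
      unfolding sum_distrib_left c_def
    proof (rule sum.cong[OF refl])
      show "H k i * (A k k * A i k) = A k k * (A k i * H k i)" for i
        using sym[of i k] by simp
    qed
    have "(\<Sum>i\<in>insert k S. \<Sum>j\<in>insert k S. H i j * (A i k * A j k)) =
        H k k * (c * c) + c * (\<Sum>i\<in>S. A i k * H i k) + c * (\<Sum>i\<in>S. A k i * H k i)
        + (\<Sum>i\<in>S. \<Sum>j\<in>S. H i j * (A i k * A j k))"
      using quadratic_form_insert[OF insert.hyps, of H "\<lambda>i j. A i k * A j k"] unfolding 1 2
      by (simp only: c_def)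
    then show ?thesis
      using c by (simp add: add_divide_distrib flip: c_def)
  qed
  moreover note quadratic_form_insert[OF insert.hyps, of A H] QB[of H]
  ultimately show ?case by linarith
qed

text \<open>
  A diffusion matrix need not be symmetric, but against the symmetric matrix of second derivatives only
  its symmetric part counts.
\<close>

lemma trace_product_nonpos:
  fixes A H :: "'i::finite \<Rightarrow> 'i \<Rightarrow> real"
  assumes sym: "\<And>i j. H i j = H j i"
    and pos: "\<And>v. \<exists>i. v i \<noteq> 0 \<Longrightarrow> (\<Sum>i\<in>UNIV. \<Sum>j\<in>UNIV. A i j * (v i * v j)) > 0"
    and neg: "\<And>v. (\<Sum>i\<in>UNIV. \<Sum>j\<in>UNIV. H i j * (v i * v j)) \<le> 0"
  shows "(\<Sum>i\<in>UNIV. \<Sum>j\<in>UNIV. A i j * H i j) \<le> 0"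
proof -
  have symmetrise: "(\<Sum>i\<in>UNIV. \<Sum>j\<in>UNIV. (A i j + A j i) / 2 * Z i j) =
      (\<Sum>i\<in>UNIV. \<Sum>j\<in>UNIV. A i j * Z i j)"
    if Z: "\<And>i j. Z i j = Z j i" for Z
  proof -
    have "(\<Sum>i\<in>UNIV. \<Sum>j\<in>UNIV. A j i * Z i j) = (\<Sum>i\<in>UNIV. \<Sum>j\<in>UNIV. A i j * Z i j)"
      by (subst sum.swap) (simp add: Z)
    then show ?thesis
      by (simp add: add_divide_distrib distrib_right sum.distrib flip: sum_divide_distrib)
  qed
  have "(\<Sum>i\<in>UNIV. \<Sum>j\<in>UNIV. (A i j + A j i) / 2 * H i j) \<le> 0"
  proof (rule trace_product_nonpos_symmetric)
    show "(\<Sum>i\<in>UNIV. \<Sum>j\<in>UNIV. (A i j + A j i) / 2 * (v i * v j)) > 0"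
      if "\<exists>i\<in>UNIV. v i \<noteq> 0" for v
      using pos[of v] that by (subst symmetrise) (auto simp: mult.commute)
  qed (auto simp: neg add.commute)
  then show ?thesis by (subst (asm) symmetrise) (rule sym)
qed

section \<open>Second-order conditions at an interior maximum\<close>

lemma line_partial_shift:
  fixes w :: "real^'n \<Rightarrow> real"
  assumes "((\<lambda>h. w (z + t *\<^sub>R e + h *\<^sub>R e)) has_real_derivative D) (at 0)"
  shows "((\<lambda>h. w (z + h *\<^sub>R e)) has_real_derivative D) (at t)"
  using assms DERIV_shift[of "\<lambda>h. w (z + h *\<^sub>R e)" D 0 t]
  by (simp add: algebra_simps)

lemma eventually_close_to_value:
  fixes f :: "'a::t2_space \<Rightarrow> real"
  assumes "continuous_on G f" "open G" "z \<in> G" "e > 0"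
  shows "\<forall>\<^sub>F y in nhds z. \<bar>f y - f z\<bar> < e"
proof -
  have "isCont f z"
    using assms by (simp add: continuous_on_eq_continuous_at)
  then have "(f \<longlongrightarrow> f z) (nhds z)"
    unfolding isCont_def tendsto_at_iff_tendsto_nhds .
  from tendstoD[OF this \<open>e > 0\<close>] show ?thesis by (simp add: dist_real_def)
qed

text \<open>
  The increment \<open>y - z\<close> is built up one coordinate at a time; along each coordinate the mean value
  theorem applies, and the intermediate points stay as close to \<open>z\<close> as \<open>y\<close> is.
\<close>

lemma has_derivative_of_continuous_partials:
  fixes w :: "real^'n \<Rightarrow> real"
  assumes G: "open G" and z: "z \<in> G"
    and p: "\<And>j z. z \<in> G \<Longrightarrow> ((\<lambda>h. w (z + h *\<^sub>R axis j 1)) has_real_derivative p j z) (at 0)"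
    and cont: "\<And>j. continuous_on G (p j)"
  shows "(w has_derivative (\<lambda>v. \<Sum>j\<in>UNIV. v $ j * p j z)) (at z)"
  unfolding has_derivative_at_alt
proof (intro conjI allI impI)
  show "bounded_linear (\<lambda>v. \<Sum>j\<in>UNIV. v $ j * p j z)"
    by (intro bounded_linear_sum bounded_linear_mult_const bounded_linear_vec_nth)
  fix e :: real assume e: "e > 0"
  define e' where "e' = e / CARD('n)"
  have e': "e' > 0" using e by (simp add: e'_def)
  have "\<forall>\<^sub>F y in nhds z. \<forall>j. \<bar>p j y - p j z\<bar> < e'"
  proof (intro eventually_all_finite)
    fix j
    show "\<forall>\<^sub>F y in nhds z. \<bar>p j y - p j z\<bar> < e'"
      using eventually_close_to_value[OF cont G z e'] .
  qed
  moreover have "\<forall>\<^sub>F y in nhds z. y \<in> G"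
    using G z by (rule eventually_nhds_in_open)
  ultimately have "\<forall>\<^sub>F y in nhds z. y \<in> G \<and> (\<forall>j. \<bar>p j y - p j z\<bar> < e')"
    by eventually_elim auto
  then obtain d where d: "d > 0"
    and near: "\<And>y. dist y z < d \<Longrightarrow> y \<in> G \<and> (\<forall>j. \<bar>p j y - p j z\<bar> < e')"
    unfolding eventually_nhds_metric by blast
  show "\<exists>d>0. \<forall>y. norm (y - z) < d \<longrightarrow>
          norm (w y - w z - (\<Sum>j\<in>UNIV. (y - z) $ j * p j z)) \<le> e * norm (y - z)"
  proof (intro exI[of _ d] conjI allI impI d)
    fix y assume y: "norm (y - z) < d"
    define v where "v = y - z"
    define vS where "vS S = (\<Sum>j\<in>S. v $ j *\<^sub>R axis j (1::real))" for S
    have vS_nth: "vS S $ i = (if i \<in> S then v $ i else 0)" for S i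
      by (simp add: vS_def axis_def if_distrib cong: if_cong)
    have close: "dist (z + (vS S + t *\<^sub>R axis k 1)) z < d"
      if "k \<notin> S" "\<bar>t\<bar> \<le> \<bar>v $ k\<bar>" for S k t
    proof -
      have "norm (vS S + t *\<^sub>R axis k 1) \<le> norm v"
        by (rule norm_le_componentwise_cart) (use that in \<open>auto simp: vS_nth axis_def\<close>)
      then show ?thesis using y by (simp add: dist_norm v_def)
    qed
    have "\<bar>w (z + vS S) - w z - (\<Sum>j\<in>S. v $ j * p j z)\<bar> \<le> (\<Sum>j\<in>S. e' * \<bar>v $ j\<bar>)" if "finite S" for S
      using that
    proof induction
      case empty
      then show ?case by (simp add: vS_def)
    next
      case (insert k S)
      define \<psi> where "\<psi> t = w (z + vS S + t *\<^sub>R axis k 1) - t * p k z" for t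
      have "norm (\<psi> (v $ k) - \<psi> 0) \<le> e' * norm (v $ k - 0)"
      proof (rule field_differentiable_bound[where S="closed_segment 0 (v $ k)"
            and f'="\<lambda>t. p k (z + vS S + t *\<^sub>R axis k 1) - p k z"])
        fix t assume t: "t \<in> closed_segment 0 (v $ k)"
        then have "\<bar>t\<bar> \<le> \<bar>v $ k\<bar>"
          by (auto simp: closed_segment_eq_real_ivl split: if_splits)
        from near[OF close[OF insert.hyps(2) this]]
        have *: "z + vS S + t *\<^sub>R axis k 1 \<in> G" "\<bar>p k (z + vS S + t *\<^sub>R axis k 1) - p k z\<bar> < e'"
          by (auto simp: add.assoc)
        show "norm (p k (z + vS S + t *\<^sub>R axis k 1) - p k z) \<le> e'"
          using * by simp
        have "((\<lambda>h. w (z + vS S + h *\<^sub>R axis k 1)) has_real_derivative p k (z + vS S + t *\<^sub>R axis k 1)) (at t)"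
          by (rule line_partial_shift) (rule p[OF *(1)])
        then show "(\<psi> has_real_derivative p k (z + vS S + t *\<^sub>R axis k 1) - p k z)
            (at t within closed_segment 0 (v $ k))"
          unfolding \<psi>_def by (auto intro!: derivative_eq_intros intro: has_field_derivative_at_within)
      qed auto
      moreover have "vS (insert k S) = vS S + v $ k *\<^sub>R axis k 1"
        using insert.hyps by (simp add: vS_def)
      ultimately show ?case
        using insert.IH insert.hyps by (simp add: \<psi>_def add.assoc)
    qed
    from this[of UNIV] have "\<bar>w y - w z - (\<Sum>j\<in>UNIV. (y - z) $ j * p j z)\<bar> \<le> (\<Sum>j\<in>UNIV. e' * \<bar>v $ j\<bar>)"
    proof -
      have "vS UNIV = v" by (simp add: vec_eq_iff vS_nth)
      then show ?thesis using \<open>finite UNIV \<Longrightarrow> _\<close> by (simp add: v_def)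
    qed
    also have "\<dots> \<le> (\<Sum>j\<in>(UNIV::'n set). e' * norm v)"
      using e' by (intro sum_mono mult_left_mono component_le_norm_cart) auto
    also have "\<dots> = e * norm (y - z)" by (simp add: e'_def v_def)
    finally show "norm (w y - w z - (\<Sum>j\<in>UNIV. (y - z) $ j * p j z)) \<le> e * norm (y - z)"
      by simp
  qed
qed

text \<open>
  The second difference is symmetric in \<open>i\<close> and \<open>j\<close>, whereas its expression by two applications
  of the mean value theorem is not; comparing both orders gives the symmetry of second derivatives.
\<close>

lemma second_difference_eq_mixed_partial:
  fixes w :: "real^'n \<Rightarrow> real"
  assumes B: "ball z d \<subseteq> G" and s: "0 < s" "2 * s < d"
    and p: "\<And>j z. z \<in> G \<Longrightarrow> ((\<lambda>h. w (z + h *\<^sub>R axis j 1)) has_real_derivative p j z) (at 0)"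
    and q: "\<And>i j z. z \<in> G \<Longrightarrow> ((\<lambda>h. p j (z + h *\<^sub>R axis i 1)) has_real_derivative q i j z) (at 0)"
  shows "\<exists>y\<in>ball z d. w (z + s *\<^sub>R axis i 1 + s *\<^sub>R axis j 1) - w (z + s *\<^sub>R axis i 1)
            - w (z + s *\<^sub>R axis j 1) + w z = s\<^sup>2 * q i j y"
proof -
  have inb: "z + s1 *\<^sub>R axis i 1 + s2 *\<^sub>R axis j 1 \<in> ball z d" if "0 \<le> s1" "s1 \<le> s" "0 \<le> s2" "s2 \<le> s" for s1 s2
  proof -
    have "norm (s1 *\<^sub>R axis i 1 + s2 *\<^sub>R axis j (1::real)) \<le> s1 + s2"
      by (rule norm_triangle_le) (use that in \<open>simp add: norm_axis_1\<close>)
    then show ?thesis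
      using that s by (simp add: dist_norm add.assoc norm_minus_commute)
        (simp add: add.commute)
  qed
  define \<phi> where "\<phi> r = w (z + s *\<^sub>R axis i 1 + r *\<^sub>R axis j 1) - w (z + r *\<^sub>R axis j 1)" for r
  have "\<exists>r>0. r < s \<and> \<phi> s - \<phi> 0 =
      (s - 0) * (p j (z + s *\<^sub>R axis i 1 + r *\<^sub>R axis j 1) - p j (z + r *\<^sub>R axis j 1))"
  proof (rule MVT2)
    fix r assume r: "0 \<le> r" "r \<le> s"
    have "z + r *\<^sub>R axis j 1 \<in> G" "z + s *\<^sub>R axis i 1 + r *\<^sub>R axis j 1 \<in> G"
      using inb[of 0 r] inb[of s r] r s B by auto
    then show "(\<phi> has_real_derivative
        p j (z + s *\<^sub>R axis i 1 + r *\<^sub>R axis j 1) - p j (z + r *\<^sub>R axis j 1)) (at r)"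
      unfolding \<phi>_def by - (rule DERIV_diff; rule line_partial_shift; rule p; assumption)
  qed (use s in simp)
  then obtain r where r: "0 < r" "r < s" and \<phi>r: "\<phi> s - \<phi> 0 =
      s * (p j (z + s *\<^sub>R axis i 1 + r *\<^sub>R axis j 1) - p j (z + r *\<^sub>R axis j 1))"
    by auto
  define \<omega> where "\<omega> t = p j (z + r *\<^sub>R axis j 1 + t *\<^sub>R axis i 1)" for t
  have "\<exists>t>0. t < s \<and> \<omega> s - \<omega> 0 = (s - 0) * q i j (z + r *\<^sub>R axis j 1 + t *\<^sub>R axis i 1)"
  proof (rule MVT2)
    fix t assume t: "0 \<le> t" "t \<le> s"
    have "z + r *\<^sub>R axis j 1 + t *\<^sub>R axis i 1 \<in> G"
      using inb[of t r] r t B by (auto simp: add_ac)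
    then show "(\<omega> has_real_derivative q i j (z + r *\<^sub>R axis j 1 + t *\<^sub>R axis i 1)) (at t)"
      unfolding \<omega>_def by - (rule line_partial_shift, rule q)
  qed (use s in simp)
  then obtain t where t: "0 < t" "t < s"
    and \<omega>t: "\<omega> s - \<omega> 0 = s * q i j (z + r *\<^sub>R axis j 1 + t *\<^sub>R axis i 1)"
    by auto
  show ?thesis
  proof (intro bexI)
    show "z + r *\<^sub>R axis j 1 + t *\<^sub>R axis i 1 \<in> ball z d"
      using inb[of t r] r t by (simp add: add_ac)
    have "\<phi> s - \<phi> 0 = s * (\<omega> s - \<omega> 0)"
      using \<phi>r by (simp add: \<omega>_def add_ac)
    then show "w (z + s *\<^sub>R axis i 1 + s *\<^sub>R axis j 1) - w (z + s *\<^sub>R axis i 1)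
            - w (z + s *\<^sub>R axis j 1) + w z = s\<^sup>2 * q i j (z + r *\<^sub>R axis j 1 + t *\<^sub>R axis i 1)"
      using \<omega>t by (simp add: \<phi>_def power2_eq_square)
  qed
qed

lemma mixed_partials_commute:
  fixes w :: "real^'n \<Rightarrow> real"
  assumes G: "open G" and z: "z \<in> G"
    and p: "\<And>j z. z \<in> G \<Longrightarrow> ((\<lambda>h. w (z + h *\<^sub>R axis j 1)) has_real_derivative p j z) (at 0)"
    and q: "\<And>i j z. z \<in> G \<Longrightarrow> ((\<lambda>h. p j (z + h *\<^sub>R axis i 1)) has_real_derivative q i j z) (at 0)"
    and cont: "\<And>i j. continuous_on G (q i j)"
  shows "q i j z = q j i z"
proof -
  have "\<bar>q i j z - q j i z\<bar> \<le> e" if e: "e > 0" for e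
  proof -
    have near: "\<forall>\<^sub>F y in nhds z. \<bar>q i j y - q i j z\<bar> < e / 2" for i j
      by (rule eventually_close_to_value[OF cont G z]) (use e in simp)
    have "\<forall>\<^sub>F y in nhds z. y \<in> G"
      using G z by (rule eventually_nhds_in_open)
    with near[of i j] near[of j i]
    have "\<forall>\<^sub>F y in nhds z. y \<in> G \<and> \<bar>q i j y - q i j z\<bar> < e / 2 \<and> \<bar>q j i y - q j i z\<bar> < e / 2"
      by eventually_elim auto
    then obtain d where d: "d > 0" and near:
      "\<And>y. dist y z < d \<Longrightarrow> y \<in> G \<and> \<bar>q i j y - q i j z\<bar> < e / 2 \<and> \<bar>q j i y - q j i z\<bar> < e / 2"
      unfolding eventually_nhds_metric by blast
    have B: "ball z d \<subseteq> G" using near by (auto simp: dist_commute)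
    define s where "s = d / 3"
    have s: "0 < s" "2 * s < d" using d by (auto simp: s_def)
    obtain y where y: "y \<in> ball z d" "w (z + s *\<^sub>R axis i 1 + s *\<^sub>R axis j 1) - w (z + s *\<^sub>R axis i 1)
            - w (z + s *\<^sub>R axis j 1) + w z = s\<^sup>2 * q i j y"
      using second_difference_eq_mixed_partial[OF B s p q] by blast
    obtain y' where y': "y' \<in> ball z d" "w (z + s *\<^sub>R axis j 1 + s *\<^sub>R axis i 1) - w (z + s *\<^sub>R axis j 1)
            - w (z + s *\<^sub>R axis i 1) + w z = s\<^sup>2 * q j i y'"
      using second_difference_eq_mixed_partial[OF B s p q] by blast
    have "s\<^sup>2 * q i j y = s\<^sup>2 * q j i y'"
    proof -
      have "z + s *\<^sub>R axis j 1 + s *\<^sub>R axis i 1 = z + s *\<^sub>R axis i 1 + s *\<^sub>R axis j 1"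
        by (simp add: add_ac)
      with y(2) y'(2) show ?thesis by (simp only:)
    qed
    then have "q i j y = q j i y'" using s by simp
    then show ?thesis
    proof -
      have "\<bar>q i j y - q i j z\<bar> < e / 2" "\<bar>q j i y' - q j i z\<bar> < e / 2"
        using near[of y] near[of y'] y(1) y'(1) by (auto simp: dist_commute)
      then show ?thesis using \<open>q i j y = q j i y'\<close> by linarith
    qed
  qed
  then show ?thesis
    using field_le_epsilon[of "\<bar>q i j z - q j i z\<bar>" 0] by simp
qed

lemma second_derivative_nonpos_at_max:
  fixes g :: "real \<Rightarrow> real"
  assumes d: "d > 0" and g': "\<And>h. \<bar>h\<bar> < d \<Longrightarrow> (g has_real_derivative g' h) (at h)"
    and g'': "(g' has_real_derivative D) (at 0)"
    and max: "\<And>h. \<bar>h\<bar> < d \<Longrightarrow> g h \<le> g 0"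
  shows "D \<le> 0"
proof (rule ccontr)
  assume "\<not> D \<le> 0"
  have g'0: "g' 0 = 0"
    by (rule DERIV_local_max[OF g'[of 0] d]) (use d max in auto)
  from DERIV_pos_inc_right[OF g''] \<open>\<not> D \<le> 0\<close>
  obtain e where e: "e > 0" "\<And>h. 0 < h \<Longrightarrow> h < e \<Longrightarrow> g' h > 0"
    using g'0 by auto
  define h where "h = min d e / 2"
  have h: "0 < h" "h < d" "h < e" using d e(1) by (auto simp: h_def)
  obtain t where "0 < t" "t < h" "g h - g 0 = (h - 0) * g' t"
    using MVT2[of 0 h g g'] g' h by auto
  then show False
    using e(2)[of t] max[of h] h by (smt (verit) mult_pos_pos)
qed

text \<open>
  Restriction to the line through \<open>z\<close> in direction \<open>v\<close> reduces the claim to one variable. The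
  chain rule along that line needs total derivatives of \<open>w\<close> and of its first partial derivatives,
  which is why all partial derivatives are required to be continuous.
\<close>

lemma second_order_condition_at_max:
  fixes w :: "real^'n \<Rightarrow> real"
  assumes G: "open G" and z: "z \<in> G"
    and p: "\<And>j z. z \<in> G \<Longrightarrow> ((\<lambda>h. w (z + h *\<^sub>R axis j 1)) has_real_derivative p j z) (at 0)"
    and q: "\<And>i j z. z \<in> G \<Longrightarrow> ((\<lambda>h. p j (z + h *\<^sub>R axis i 1)) has_real_derivative q i j z) (at 0)"
    and contp: "\<And>j. continuous_on G (p j)"
    and contq: "\<And>i j. continuous_on G (q i j)"
    and max: "\<And>y. y \<in> G \<Longrightarrow> w y \<le> w z"
  shows "p j z = 0" and "(\<Sum>i\<in>UNIV. \<Sum>j\<in>UNIV. q i j z * (v i * v j)) \<le> 0"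
proof -
  obtain d where d: "d > 0" "ball z d \<subseteq> G"
    using G z openE by blast
  have "(\<bar>0 - h\<bar> < d \<longrightarrow> w (z + h *\<^sub>R axis j 1) \<le> w (z + 0 *\<^sub>R axis j 1))" for h
    using d by (auto intro!: max subsetD[OF d(2)] simp: dist_norm norm_axis_1)
  then show "p j z = 0"
    using DERIV_local_max[OF p[OF z] d(1)] by blast
  define V where "V = (\<chi> i. v i)"
  obtain e where e: "e > 0" "\<And>h. \<bar>h\<bar> < e \<Longrightarrow> z + h *\<^sub>R V \<in> G"
  proof -
    have "norm (h *\<^sub>R V) < d" if "\<bar>h\<bar> < d / (norm V + 1)" for h
    proof -
      have "norm (h *\<^sub>R V) \<le> \<bar>h\<bar> * (norm V + 1)" by (simp add: mult_left_mono)
      also have "\<dots> < d" using that by (simp add: pos_less_divide_eq add_nonneg_pos)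
      finally show ?thesis .
    qed
    then show ?thesis
      using d by (intro that[of "d / (norm V + 1)"]) (auto simp: dist_norm add_nonneg_pos intro!: subsetD[OF d(2)])
  qed
  have chain: "((\<lambda>h. u (z + h *\<^sub>R V)) has_real_derivative (\<Sum>j\<in>UNIV. v j * r j (z + h *\<^sub>R V))) (at h)"
    if u: "\<And>j z. z \<in> G \<Longrightarrow> ((\<lambda>h. u (z + h *\<^sub>R axis j 1)) has_real_derivative r j z) (at 0)"
      and r: "\<And>j. continuous_on G (r j)" and h: "\<bar>h\<bar> < e" for u r h
  proof -
    have "((\<lambda>h. z + h *\<^sub>R V) has_derivative (\<lambda>h. h *\<^sub>R V)) (at h)"
      by (auto intro!: derivative_eq_intros)
    from has_derivative_compose[OF this has_derivative_of_continuous_partials[OF G e(2)[OF h] u r]]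
    show ?thesis
      unfolding has_field_derivative_def
      by (rule has_derivative_eq_rhs) (auto simp: V_def fun_eq_iff sum_distrib_left sum_distrib_right mult_ac)
  qed
  have "(\<Sum>j\<in>UNIV. v j * (\<Sum>i\<in>UNIV. v i * q i j z)) \<le> 0"
  proof (rule second_derivative_nonpos_at_max[OF e(1)])
    show "((\<lambda>h. w (z + h *\<^sub>R V)) has_real_derivative (\<Sum>j\<in>UNIV. v j * p j (z + h *\<^sub>R V))) (at h)"
      if "\<bar>h\<bar> < e" for h by (rule chain[OF p contp that])
    show "((\<lambda>h. \<Sum>j\<in>UNIV. v j * p j (z + h *\<^sub>R V)) has_real_derivative
        (\<Sum>j\<in>UNIV. v j * (\<Sum>i\<in>UNIV. v i * q i j z))) (at 0)"
      using chain[OF q contq, of 0] e(1) by (intro DERIV_sum DERIV_cmult) simp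
    show "w (z + h *\<^sub>R V) \<le> w (z + 0 *\<^sub>R V)" if "\<bar>h\<bar> < e" for h
      using max[OF e(2)[OF that]] by simp
  qed
  then show "(\<Sum>i\<in>UNIV. \<Sum>j\<in>UNIV. q i j z * (v i * v j)) \<le> 0"
    by (subst sum.swap) (simp add: sum_distrib_left mult_ac)
qed

section \<open>The parabolic comparison principle\<close>

lemma C12_partials:
  fixes x :: "real \<Rightarrow> real^'n \<Rightarrow> real"
  assumes x: "C12 G x" and t: "t > 0"
  shows "z \<in> G \<Longrightarrow> ((\<lambda>h. x t (z + h *\<^sub>R axis j 1)) has_real_derivative partial_z j (x t) z) (at 0)"
    and "z \<in> G \<Longrightarrow> ((\<lambda>h. partial_z j (x t) (z + h *\<^sub>R axis i 1)) has_real_derivative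
           partial_z i (partial_z j (x t)) z) (at 0)"
    and "z \<in> G \<Longrightarrow> ((\<lambda>s. x s z) has_real_derivative partial_t x t z) (at t)"
    and "continuous_on G (partial_z j (x t))"
    and "continuous_on G (partial_z i (partial_z j (x t)))"
proof -
  have slice: "continuous_on G (\<lambda>z. h t z)"
    if "continuous_on ({0<..} \<times> G) (\<lambda>(t, z). h t z)" for h :: "real \<Rightarrow> real^'n \<Rightarrow> real"
  proof -
    have "continuous_on G (\<lambda>z. (\<lambda>(t, z). h t z) (t, z))"
      by (rule continuous_on_compose2[OF that]) (use t in \<open>auto intro!: continuous_intros\<close>)
    then show ?thesis by simp
  qed
  show "continuous_on G (partial_z j (x t))" "continuous_on G (partial_z i (partial_z j (x t)))"
    using x slice unfolding C12_def by blast+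
  show "((\<lambda>h. x t (z + h *\<^sub>R axis j 1)) has_real_derivative partial_z j (x t) z) (at 0)"
    and "((\<lambda>h. partial_z j (x t) (z + h *\<^sub>R axis i 1)) has_real_derivative
           partial_z i (partial_z j (x t)) z) (at 0)"
    and "((\<lambda>s. x s z) has_real_derivative partial_t x t z) (at t)" if "z \<in> G"
    using x t that unfolding C12_def has_partial_z_def
    by (auto simp: partial_z_def[of _ "x t"] partial_z_def[of _ "partial_z j (x t)"] partial_t_def
        simp flip: DERIV_deriv_iff_real_differentiable)
qed

lemma parabolic_operator_at_interior_max:
  fixes a :: "'n::finite \<Rightarrow> 'n \<Rightarrow> real^'n \<Rightarrow> real"
  assumes G: "open G" and par: "uniformly_parabolic G a"
    and x: "C12 G x" and y: "C12 G y" and t: "t > 0" and z: "z \<in> G"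
    and max: "\<And>z'. z' \<in> G \<Longrightarrow> x t z' - y t z' \<le> x t z - y t z"
  shows "grad_z (x t) z = grad_z (y t) z"
    and "(\<Sum>i\<in>UNIV. \<Sum>j\<in>UNIV. a i j z * partial_z i (partial_z j (x t)) z) \<le>
         (\<Sum>i\<in>UNIV. \<Sum>j\<in>UNIV. a i j z * partial_z i (partial_z j (y t)) z)"
proof -
  define p where "p j z = partial_z j (x t) z - partial_z j (y t) z" for j z
  define q where "q i j z = partial_z i (partial_z j (x t)) z - partial_z i (partial_z j (y t)) z" for i j z
  note D = C12_partials[OF x t] C12_partials[OF y t]
  have p: "((\<lambda>h. x t (z + h *\<^sub>R axis j 1) - y t (z + h *\<^sub>R axis j 1)) has_real_derivative p j z) (at 0)"
    if "z \<in> G" for j z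
    unfolding p_def by (intro DERIV_diff D that)
  have q: "((\<lambda>h. p j (z + h *\<^sub>R axis i 1)) has_real_derivative q i j z) (at 0)"
    if "z \<in> G" for i j z
    unfolding p_def q_def by (intro DERIV_diff D that)
  have contp: "continuous_on G (p j)" for j
    unfolding p_def by (intro continuous_on_diff D)
  have contq: "continuous_on G (q i j)" for i j
    unfolding q_def by (intro continuous_on_diff D)
  note second_order = second_order_condition_at_max
    [where w="\<lambda>z. x t z - y t z", OF G z p q contp contq max]
  show "grad_z (x t) z = grad_z (y t) z"
    using second_order(1) by (simp add: grad_z_def vec_eq_iff p_def)
  obtain K where K: "K > 0" and par':
    "\<And>\<xi>. (\<Sum>i\<in>UNIV. \<Sum>j\<in>UNIV. a i j z * \<xi> $ i * \<xi> $ j) \<ge> K * (norm \<xi>)\<^sup>2"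
    using par z closure_subset unfolding uniformly_parabolic_def by blast
  have "(\<Sum>i\<in>UNIV. \<Sum>j\<in>UNIV. a i j z * q i j z) \<le> 0"
  proof (rule trace_product_nonpos)
    show "q i j z = q j i z" for i j
      by (rule mixed_partials_commute[where w="\<lambda>z. x t z - y t z", OF G z p q contq])
    show "(\<Sum>i\<in>UNIV. \<Sum>j\<in>UNIV. a i j z * (v i * v j)) > 0" if "\<exists>i. v i \<noteq> 0" for v
    proof -
      have "K * (norm (\<chi> i. v i))\<^sup>2 > 0"
        using K that by (simp add: vec_eq_iff)
      then show ?thesis using par'[of "\<chi> i. v i"] by (simp add: mult.assoc)
    qed
  qed (rule second_order(2))
  then show "(\<Sum>i\<in>UNIV. \<Sum>j\<in>UNIV. a i j z * partial_z i (partial_z j (x t)) z) \<le>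
         (\<Sum>i\<in>UNIV. \<Sum>j\<in>UNIV. a i j z * partial_z i (partial_z j (y t)) z)"
    by (simp add: q_def right_diff_distrib sum_subtractf)
qed

text \<open>
  If \<open>x - y\<close> were positive somewhere, then \<open>exp (- k * t) * (x - y)\<close> would attain a positive maximum
  over the compact cylinder, and not on its parabolic boundary. At the maximal point the gradients
  coincide and the second order terms are ordered, so \<open>H2\<close> with its constant \<open>k\<close> for the range of
  the two functions bounds the time derivative of \<open>x - y\<close> strictly by \<open>k * (x - y)\<close>. The weighted
  difference is then strictly decreasing in time at a point where it is maximal. Since \<open>H2\<close> is a
  strict inequality, the weight with this very \<open>k\<close> suffices.
\<close>

theorem parabolic_comparison:
  fixes a :: "'n::finite \<Rightarrow> 'n \<Rightarrow> real^'n \<Rightarrow> real"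
  assumes G: "open G" "bounded G" and par: "uniformly_parabolic G a" and H2: "H2 G f"
    and x: "x \<in> CL G" and y: "y \<in> CL G"
    and L: "\<And>t z. 0 < t \<Longrightarrow> t \<le> T \<Longrightarrow> z \<in> G \<Longrightarrow> L_op a f x t z \<le> L_op a f y t z"
    and init: "\<And>z. z \<in> G \<Longrightarrow> x 0 z \<le> y 0 z"
    and bdry: "\<And>t z. 0 \<le> t \<Longrightarrow> t \<le> T \<Longrightarrow> z \<in> frontier G \<Longrightarrow> x t z \<le> y t z"
    and t: "0 \<le> t" "t \<le> T" and z: "z \<in> closure G"
  shows "x t z \<le> y t z"
proof (rule ccontr)
  assume "\<not> x t z \<le> y t z"
  define Q where "Q = {0..T} \<times> closure G"
  have compactQ: "compact Q"
    unfolding Q_def using G by (intro compact_Times) (auto simp: compact_closure)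
  have cont: "continuous_on Q (\<lambda>(t, z). x t z)" "continuous_on Q (\<lambda>(t, z). y t z)"
    using x y unfolding CL_def Q_def
    by (auto elim!: continuous_on_subset)
  define W where "W = (\<lambda>(t, z). x t z) ` Q \<union> (\<lambda>(t, z). y t z) ` Q"
  have "bounded W"
    unfolding W_def using compactQ cont by (auto intro!: compact_imp_bounded compact_continuous_image)
  with H2 obtain k where k: "k > 0" and f: "\<And>w1 w2 z \<xi>. w1 \<in> W \<Longrightarrow> w2 \<in> W \<Longrightarrow> w1 > w2 \<Longrightarrow> z \<in> G \<Longrightarrow>
      f z w1 \<xi> - f z w2 \<xi> < k * (w1 - w2)"
    unfolding H2_def by metis
  define m where "m t z = exp (- k * t) * (x t z - y t z)" for t z
  have "continuous_on Q (\<lambda>(t, z). m t z)"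
    using cont unfolding m_def split_beta by (intro continuous_intros)
  moreover have "(t, z) \<in> Q" using t z by (simp add: Q_def)
  ultimately obtain t0 z0 where Q0: "(t0, z0) \<in> Q" and m0: "\<And>t z. (t, z) \<in> Q \<Longrightarrow> m t z \<le> m t0 z0"
    using continuous_attains_sup[OF compactQ, of "\<lambda>(t, z). m t z"] by fastforce
  have "0 < m t z" using \<open>\<not> x t z \<le> y t z\<close> by (simp add: m_def)
  also have "\<dots> \<le> m t0 z0" by (rule m0) fact
  finally have gt: "x t0 z0 > y t0 z0"
    by (simp add: m_def zero_less_mult_iff)
  have T0: "0 \<le> t0" "t0 \<le> T" and "z0 \<in> closure G" using Q0 by (auto simp: Q_def)
  with bdry gt have zG: "z0 \<in> G"
    using closure_Un_frontier[of G] by fastforce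
  with init gt T0 have t0: "t0 > 0"
    by (cases "t0 = 0") fastforce+
  have xy: "C12 G x" "C12 G y" using x y by (auto simp: CL_def)
  have "x t0 z' - y t0 z' \<le> x t0 z0 - y t0 z0" if "z' \<in> G" for z'
    using m0[of t0 z'] that T0 closure_subset[of G] by (auto simp: m_def Q_def)
  from parabolic_operator_at_interior_max[OF G(1) par xy t0 zG this]
  have grad: "grad_z (x t0) z0 = grad_z (y t0) z0"
    and elliptic: "(\<Sum>i\<in>UNIV. \<Sum>j\<in>UNIV. a i j z0 * partial_z i (partial_z j (x t0)) z0) \<le>
         (\<Sum>i\<in>UNIV. \<Sum>j\<in>UNIV. a i j z0 * partial_z i (partial_z j (y t0)) z0)"
    by auto
  have "f z0 (x t0 z0) (grad_z (x t0) z0) - f z0 (y t0 z0) (grad_z (x t0) z0) < k * (x t0 z0 - y t0 z0)"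
    using Q0 gt zG by (intro f) (force simp: W_def)+
  with L[OF t0 T0(2) zG] elliptic
  have less: "partial_t x t0 z0 - partial_t y t0 z0 < k * (x t0 z0 - y t0 z0)"
    by (simp add: L_op_def grad)
  have "((\<lambda>s. x s z0) has_real_derivative partial_t x t0 z0) (at t0)"
       "((\<lambda>s. y s z0) has_real_derivative partial_t y t0 z0) (at t0)"
    using xy C12_partials(3)[OF _ t0 zG] by auto
  then have m': "((\<lambda>s. m s z0) has_real_derivative exp (- k * t0) *
      ((partial_t x t0 z0 - partial_t y t0 z0) - k * (x t0 z0 - y t0 z0))) (at t0)"
    unfolding m_def by (auto intro!: derivative_eq_intros simp: algebra_simps)
  have neg: "exp (- k * t0) * ((partial_t x t0 z0 - partial_t y t0 z0) - k * (x t0 z0 - y t0 z0)) < 0"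
    using less by (simp add: mult_less_0_iff)
  obtain d where d: "d > 0" "\<And>h. 0 < h \<Longrightarrow> h < d \<Longrightarrow> m t0 z0 < m (t0 - h) z0"
    using DERIV_neg_dec_left[OF m' neg] by auto
  define h where "h = min d t0 / 2"
  have h: "0 < h" "h < d" "h < t0" using d(1) t0 by (auto simp: h_def)
  have "m (t0 - h) z0 \<le> m t0 z0"
    using h T0 \<open>z0 \<in> closure G\<close> by (intro m0) (auto simp: Q_def)
  with d(2)[OF h(1,2)] show False by simp
qed

section \<open>Supremum norms\<close>

lemma sup_norm_upper:
  assumes "bdd_above ((\<lambda>s. \<bar>w s\<bar>) ` S)" "s \<in> S"
  shows "\<bar>w s\<bar> \<le> sup_norm S w"
  unfolding sup_norm_def using assms by (intro cSUP_upper)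

lemma sup_norm_least:
  assumes "S \<noteq> {}" "\<And>s. s \<in> S \<Longrightarrow> \<bar>w s\<bar> \<le> c"
  shows "sup_norm S w \<le> c"
  unfolding sup_norm_def using assms by (intro cSUP_least)

text \<open>
  Stated for an evaluation map \<open>ev\<close> so that it serves both for functions on a set and for inputs,
  which are functions of time and space in curried form.
\<close>

lemma normed_linear_space_sup_norm:
  fixes V :: "'v::real_vector set" and ev :: "'v \<Rightarrow> 's \<Rightarrow> real"
  assumes "subspace V" and S: "S \<noteq> {}"
    and add: "\<And>v w s. ev (v + w) s = ev v s + ev w s"
    and scale: "\<And>c v s. ev (c *\<^sub>R v) s = c * ev v s"
    and bdd: "\<And>v. v \<in> V \<Longrightarrow> bdd_above ((\<lambda>s. \<bar>ev v s\<bar>) ` S)"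
    and inj: "\<And>v. v \<in> V \<Longrightarrow> (\<And>s. s \<in> S \<Longrightarrow> ev v s = 0) \<Longrightarrow> v = 0"
  shows "normed_linear_space V (\<lambda>v. sup_norm S (ev v))"
proof
  note up = sup_norm_upper[OF bdd]
  have zero: "ev 0 s = 0" for s
    using scale[of 0 0 s] by simp
  show "subspace V" by fact
  show "sup_norm S (ev v) = 0 \<longleftrightarrow> v = 0" if "v \<in> V" for v
  proof
    assume "sup_norm S (ev v) = 0"
    then show "v = 0" using inj[OF that] up[OF that] by fastforce
  next
    assume "v = 0"
    then show "sup_norm S (ev v) = 0" using S by (simp add: sup_norm_def zero)
  qed
  show "sup_norm S (ev (v + w)) \<le> sup_norm S (ev v) + sup_norm S (ev w)" if "v \<in> V" "w \<in> V" for v w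
    using up[OF that(1)] up[OF that(2)] by (intro sup_norm_least S) (fastforce simp: add)
  have le: "sup_norm S (ev (c *\<^sub>R v)) \<le> \<bar>c\<bar> * sup_norm S (ev v)" if "v \<in> V" for c v
    using up[OF that] by (intro sup_norm_least S) (simp add: scale abs_mult mult_left_mono)
  show "sup_norm S (ev (c *\<^sub>R v)) = \<bar>c\<bar> * sup_norm S (ev v)" if v: "v \<in> V" for c v
  proof (cases "c = 0")
    case True
    then show ?thesis using S by (simp add: sup_norm_def zero)
  next
    case False
    have "c *\<^sub>R v \<in> V" using \<open>subspace V\<close> v by (rule subspace_scale)
    from le[OF this, of "inverse c"] False
    have "\<bar>c\<bar> * sup_norm S (ev v) \<le> sup_norm S (ev (c *\<^sub>R v))"
      by (simp add: field_simps)
    with le[OF v, of c] show ?thesis by simp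
  qed
qed

section \<open>The Minkowski inequality\<close>

text \<open>
  This is convexity of \<open>\<lambda>t. t powr r\<close> at the points \<open>x / \<alpha>\<close> and \<open>y / \<beta>\<close>. The points on the
  boundary of the domain, where \<open>x\<close> or \<open>y\<close> vanishes, follow from \<open>t powr r \<le> t\<close> on the unit
  interval.
\<close>

lemma powr_weighted_convex:
  fixes x y \<alpha> \<beta> r :: real
  assumes "1 \<le> r" "0 < \<alpha>" "0 < \<beta>" "0 \<le> x" "0 \<le> y"
  shows "((x + y) / (\<alpha> + \<beta>)) powr r \<le>
           \<alpha> / (\<alpha> + \<beta>) * (x / \<alpha>) powr r + \<beta> / (\<alpha> + \<beta>) * (y / \<beta>) powr r"
proof -
  have one: "(y / (\<alpha> + \<beta>)) powr r \<le> \<beta> / (\<alpha> + \<beta>) * (y / \<beta>) powr r"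
    if "0 < \<alpha>" "0 < \<beta>" "0 \<le> y" for \<alpha> \<beta> y :: real
  proof -
    have "(y / (\<alpha> + \<beta>)) powr r = (\<beta> / (\<alpha> + \<beta>)) powr r * (y / \<beta>) powr r"
      using that by (simp flip: powr_mult)
    also have "(\<beta> / (\<alpha> + \<beta>)) powr r \<le> (\<beta> / (\<alpha> + \<beta>)) powr 1"
      using that assms(1) by (intro powr_mono') auto
    finally show ?thesis using that by (simp add: mult_right_mono)
  qed
  consider "x = 0" | "y = 0" | "x > 0" "y > 0" using assms by fastforce
  then show ?thesis
  proof cases
    case 1
    then show ?thesis using one[of \<alpha> \<beta> y] assms by simp
  next
    case 2
    then show ?thesis using one[of \<beta> \<alpha> x] assms by (simp add: add.commute)
  next
    case 3
    have sum1: "\<alpha> / (\<alpha> + \<beta>) + \<beta> / (\<alpha> + \<beta>) = 1"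
      using assms by (simp flip: add_divide_distrib)
    have "(\<alpha> / (\<alpha> + \<beta>) * (x / \<alpha>) + \<beta> / (\<alpha> + \<beta>) * (y / \<beta>)) powr r \<le>
        \<alpha> / (\<alpha> + \<beta>) * (x / \<alpha>) powr r + \<beta> / (\<alpha> + \<beta>) * (y / \<beta>) powr r"
    proof -
      have "(u * x + v * y) powr r \<le> u * x powr r + v * y powr r"
        if "x > 0" "y > 0" "u \<ge> 0" "v \<ge> 0" "u + v = 1" for u v x y :: real
        using powr_convex[OF assms(1)] that unfolding convex_on_def by simp
      then show ?thesis using assms 3 sum1 by (meson divide_nonneg_pos divide_pos_pos less_imp_le add_pos_pos)
    qed
    also have "\<alpha> / (\<alpha> + \<beta>) * (x / \<alpha>) + \<beta> / (\<alpha> + \<beta>) * (y / \<beta>) = (x + y) / (\<alpha> + \<beta>)"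
      using assms by (simp add: add_divide_distrib)
    finally show ?thesis .
  qed
qed

text \<open>
  For \<open>\<alpha>\<close> and \<open>\<beta>\<close> slightly above the norms of \<open>f\<close> and \<open>g\<close>, integrating the weighted convexity
  inequality shows that \<open>(f + g) / (\<alpha> + \<beta>)\<close> has norm at most one. The slack \<open>e / 2\<close> keeps the
  weights positive if \<open>f\<close> or \<open>g\<close> vanishes almost everywhere.
\<close>

lemma Minkowski_integral_inequality:
  fixes f g :: "'a \<Rightarrow> real"
  assumes r: "1 \<le> r" and [measurable]: "f \<in> borel_measurable M" "g \<in> borel_measurable M"
    and f: "integrable M (\<lambda>x. \<bar>f x\<bar> powr r)" and g: "integrable M (\<lambda>x. \<bar>g x\<bar> powr r)"
  shows "(\<integral>x. \<bar>f x + g x\<bar> powr r \<partial>M) powr (1 / r) \<le>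
    (\<integral>x. \<bar>f x\<bar> powr r \<partial>M) powr (1 / r) + (\<integral>x. \<bar>g x\<bar> powr r \<partial>M) powr (1 / r)"
proof (rule field_le_epsilon)
  fix e :: real assume e: "e > 0"
  define N where "N h = (\<integral>x. \<bar>h x\<bar> powr r \<partial>M) powr (1 / r)" for h
  have N0: "N h \<ge> 0" for h by (simp add: N_def)
  define \<alpha> where "\<alpha> = N f + e / 2"
  define \<beta> where "\<beta> = N g + e / 2"
  have ab: "0 < \<alpha>" "0 < \<beta>" "N f \<le> \<alpha>" "N g \<le> \<beta>"
    using e N0[of f] N0[of g] by (auto simp: \<alpha>_def \<beta>_def)
  have le1: "(\<integral>x. (\<bar>h x\<bar> / c) powr r \<partial>M) \<le> 1" if "0 < c" "N h \<le> c" for h and c :: real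
  proof -
    have "(\<integral>x. (\<bar>h x\<bar> / c) powr r \<partial>M) = (\<integral>x. \<bar>h x\<bar> powr r \<partial>M) / c powr r"
      by (simp add: powr_divide that less_imp_le)
    also have "(\<integral>x. \<bar>h x\<bar> powr r \<partial>M) = N h powr r"
      using r by (simp add: N_def powr_powr)
    also have "N h powr r \<le> c powr r"
      using that r N0 by (intro powr_mono2) auto
    finally show ?thesis using that by (simp add: divide_right_mono)
  qed
  have int: "integrable M (\<lambda>x. (\<bar>h x\<bar> / c) powr r)" if "integrable M (\<lambda>x. \<bar>h x\<bar> powr r)" "0 < c" for h c
    using that by (simp add: powr_divide less_imp_le)
  define B where "B x = \<alpha> / (\<alpha> + \<beta>) * (\<bar>f x\<bar> / \<alpha>) powr r + \<beta> / (\<alpha> + \<beta>) * (\<bar>g x\<bar> / \<beta>) powr r" for x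
  have intB: "integrable M B"
    unfolding B_def using int f g ab by (intro Bochner_Integration.integrable_add integrable_mult_right) auto
  have B0: "0 \<le> B x" for x
    using ab by (simp add: B_def)
  have le: "(\<bar>f x + g x\<bar> / (\<alpha> + \<beta>)) powr r \<le> B x" for x
  proof -
    have "(\<bar>f x + g x\<bar> / (\<alpha> + \<beta>)) powr r \<le> ((\<bar>f x\<bar> + \<bar>g x\<bar>) / (\<alpha> + \<beta>)) powr r"
      using ab r by (intro powr_mono2 divide_right_mono) auto
    also have "\<dots> \<le> B x"
      unfolding B_def using ab r by (intro powr_weighted_convex) auto
    finally show ?thesis .
  qed
  have "(\<integral>x. (\<bar>f x + g x\<bar> / (\<alpha> + \<beta>)) powr r \<partial>M) \<le> (\<integral>x. B x \<partial>M)"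
    using intB le B0 by (intro integral_mono') auto
  also have "\<dots> = \<alpha> / (\<alpha> + \<beta>) * (\<integral>x. (\<bar>f x\<bar> / \<alpha>) powr r \<partial>M) + \<beta> / (\<alpha> + \<beta>) * (\<integral>x. (\<bar>g x\<bar> / \<beta>) powr r \<partial>M)"
    unfolding B_def using int f g ab by (subst Bochner_Integration.integral_add) auto
  also have "\<dots> \<le> \<alpha> / (\<alpha> + \<beta>) * 1 + \<beta> / (\<alpha> + \<beta>) * 1"
    using ab by (intro add_mono mult_left_mono le1) auto
  also have "\<dots> = 1" using ab by (simp flip: add_divide_distrib)
  also have "(\<integral>x. (\<bar>f x + g x\<bar> / (\<alpha> + \<beta>)) powr r \<partial>M) = (\<integral>x. \<bar>f x + g x\<bar> powr r \<partial>M) / (\<alpha> + \<beta>) powr r"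
    using ab by (simp add: powr_divide)
  finally have "(\<integral>x. \<bar>f x + g x\<bar> powr r \<partial>M) \<le> (\<alpha> + \<beta>) powr r"
    using ab by (simp add: divide_le_eq)
  then have "(\<integral>x. \<bar>f x + g x\<bar> powr r \<partial>M) powr (1 / r) \<le> ((\<alpha> + \<beta>) powr r) powr (1 / r)"
    using r by (intro powr_mono2) auto
  also have "\<dots> = N f + N g + e"
    using r ab by (simp add: powr_powr) (simp add: \<alpha>_def \<beta>_def)
  finally show "(\<integral>x. \<bar>f x + g x\<bar> powr r \<partial>M) powr (1 / r) \<le>
    (\<integral>x. \<bar>f x\<bar> powr r \<partial>M) powr (1 / r) + (\<integral>x. \<bar>g x\<bar> powr r \<partial>M) powr (1 / r) + e"
    by (simp add: N_def)
qed

section \<open>Continuous functions on a bounded region and their norms\<close>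

lemma subspace_C0: "subspace (C0 S)"
  by (auto simp: subspace_def C0_def zero_fun_def plus_fun_def scaleR_fun_def
      intro!: continuous_intros)

lemma C0_abs: "v \<in> C0 S \<Longrightarrow> (\<lambda>z. \<bar>v z\<bar>) \<in> C0 S"
  by (auto simp: C0_def intro!: continuous_intros)

lemma C0_bounded:
  assumes "v \<in> C0 S" "compact S"
  shows "bdd_above ((\<lambda>z. \<bar>v z\<bar>) ` S)"
  using assms by (intro compact_imp_bounded[THEN bounded_imp_bdd_above] compact_continuous_image)
    (auto simp: C0_def intro!: continuous_intros)

lemma normed_linear_space_C0:
  assumes "compact S" "S \<noteq> {}"
  shows "normed_linear_space (C0 S) (sup_norm S)"
proof -
  have "normed_linear_space (C0 S) (\<lambda>v. sup_norm S (\<lambda>z. v z))"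
    by (rule normed_linear_space_sup_norm[OF subspace_C0 assms(2)])
       (auto simp: plus_fun_def scaleR_fun_def zero_fun_def fun_eq_iff C0_bounded[OF _ assms(1)] C0_def)
  then show ?thesis by simp
qed

lemma sup_norm_mono:
  assumes "S \<noteq> {}" "bdd_above ((\<lambda>z. \<bar>w z\<bar>) ` S)" "\<And>z. z \<in> S \<Longrightarrow> \<bar>v z\<bar> \<le> \<bar>w z\<bar>"
  shows "sup_norm S v \<le> sup_norm S w"
  using assms by (intro sup_norm_least) (auto intro: order_trans[OF _ sup_norm_upper])

locale bounded_region =
  fixes G :: "(real^'n) set"
  assumes G: "open G" "bounded G" "G \<noteq> {}"
begin

lemma compact_closure_region: "compact (closure G)" and closure_nonempty: "closure G \<noteq> {}"
  using G by (auto simp: compact_closure)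

lemma frontier_subset: "frontier G \<subseteq> closure G"
  by (simp add: frontier_def)

lemma region_subset: "G \<subseteq> closure G"
  by (rule closure_subset)

lemma closure_cases:
  assumes "z \<in> closure G"
  obtains "z \<in> G" | "z \<in> frontier G"
  using assms closure_Un_frontier[of G] by blast

lemma compact_frontier_region: "compact (frontier G)"
  using G by (simp add: compact_frontier_bounded)

lemma frontier_nonempty: "frontier G \<noteq> {}"
  using frontier_not_empty[of G] G(2,3) not_bounded_UNIV by metis

lemma finite_measure_region: "finite_measure (lebesgue_on G)"
  using G by (intro finite_measure_lebesgue_on lmeasurable_open)

lemma C0_measurable: "v \<in> C0 (closure G) \<Longrightarrow> v \<in> borel_measurable (lebesgue_on G)"
  using G region_subset unfolding C0_def
  by (auto intro!: continuous_imp_measurable_on_sets_lebesgue intro: continuous_on_subset)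

text \<open>
  A closed condition that fails at a point fails on a relatively open set, which meets \<open>G\<close> in an open
  set and hence in a set of positive measure. This makes the \<open>L\<^sup>p\<close>-norms definite on continuous
  functions and identifies the essential supremum with the supremum.
\<close>

lemma C0_AE_imp_closure:
  assumes v: "v \<in> C0 (closure G)" and T: "closed T" and AE: "AE z in lebesgue_on G. v z \<in> T"
    and z: "z \<in> closure G"
  shows "v z \<in> T"
proof -
  define C where "C = {z \<in> closure G. v z \<in> T}"
  have "closed C"
    using v T continuous_closed_preimage[of "closure G" v T]
    by (simp add: C_def C0_def vimage_def Int_def)
  have "AE z \<in> G in lebesgue. z \<in> C"
    using AE G(1) region_subset by (auto simp: C_def AE_restrict_space_iff)
  then have "G \<subseteq> C"
    using mem_closed_if_AE_lebesgue_open[OF G(1) \<open>closed C\<close>] by (intro subsetI)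
  then have "closure G \<subseteq> C"
    using \<open>closed C\<close> by (simp add: closure_minimal)
  then show ?thesis using z by (auto simp: C_def)
qed

lemma Lp_norm_infinity:
  assumes v: "v \<in> C0 (closure G)"
  shows "Lp_norm G \<infinity> v = sup_norm (closure G) v"
proof -
  let ?e = "esssup (lebesgue_on G) (\<lambda>z. ereal \<bar>v z\<bar>)"
  have [measurable]: "v \<in> borel_measurable (lebesgue_on G)"
    using v by (rule C0_measurable)
  note up = sup_norm_upper[OF C0_bounded[OF v compact_closure_region]]
  have le: "?e \<le> ereal (sup_norm (closure G) v)"
    using up region_subset by (intro esssup_I AE_I2) auto
  have ge: "ereal \<bar>v z\<bar> \<le> ?e" if "z \<in> closure G" for z
  proof -
    have "AE z in lebesgue_on G. v z \<in> {w. ereal \<bar>w\<bar> \<le> ?e}"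
      using esssup_AE[of "\<lambda>z. ereal \<bar>v z\<bar>" "lebesgue_on G"] by simp
    moreover have "closed {w. ereal \<bar>w\<bar> \<le> ?e}"
      by (intro closed_Collect_le continuous_intros)
    ultimately show ?thesis using C0_AE_imp_closure[OF v _ _ that] by blast
  qed
  obtain z where z: "z \<in> closure G" using closure_nonempty by (metis ex_in_conv)
  obtain e where e: "?e = ereal e"
    using le ge[OF z] by (cases ?e) auto
  have "sup_norm (closure G) v \<le> e"
    using ge e by (intro sup_norm_least closure_nonempty) auto
  then show ?thesis using le e by (simp add: Lp_norm_def)
qed

lemma C0_powr_integrable:
  assumes v: "v \<in> C0 (closure G)" and r: "0 \<le> r"
  shows "integrable (lebesgue_on G) (\<lambda>z. \<bar>v z\<bar> powr r)"
proof -
  interpret finite_measure "lebesgue_on G" by (rule finite_measure_region)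
  have [measurable]: "v \<in> borel_measurable (lebesgue_on G)"
    using v by (rule C0_measurable)
  note up = sup_norm_upper[OF C0_bounded[OF v compact_closure_region]]
  show ?thesis
    using up r region_subset
    by (intro integrable_const_bound[where B="sup_norm (closure G) v powr r"] AE_I2)
       (auto intro!: powr_mono2)
qed

lemma Lp_norm_mono:
  assumes p: "1 \<le> p" and v: "v \<in> C0 (closure G)" and w: "w \<in> C0 (closure G)"
    and le: "\<And>z. z \<in> closure G \<Longrightarrow> \<bar>v z\<bar> \<le> \<bar>w z\<bar>"
  shows "Lp_norm G p v \<le> Lp_norm G p w"
proof (cases "p = \<infinity>")
  case True
  then show ?thesis
    using le w closure_nonempty compact_closure_region
    by (simp add: Lp_norm_infinity v C0_bounded sup_norm_mono)
next
  case False
  then obtain r where r: "p = ereal r" "1 \<le> r" using p by (cases p) auto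
  have "(\<integral>z. \<bar>v z\<bar> powr r \<partial>lebesgue_on G) \<le> (\<integral>z. \<bar>w z\<bar> powr r \<partial>lebesgue_on G)"
    using le region_subset r v w by (intro integral_mono C0_powr_integrable powr_mono2) auto
  then show ?thesis using r by (auto simp: Lp_norm_def intro!: powr_mono2)
qed

lemma normed_linear_space_Lp:
  assumes p: "1 \<le> p"
  shows "normed_linear_space (C0 (closure G)) (Lp_norm G p)"
proof (cases "p = \<infinity>")
  case True
  interpret sup: normed_linear_space "C0 (closure G)" "sup_norm (closure G)"
    by (intro normed_linear_space_C0 compact_closure_region closure_nonempty)
  show ?thesis
    unfolding normed_linear_space_def True
    using sup.subspace sup.nrm_eq_0 sup.nrm_triangle sup.nrm_scaleR
    by (auto simp: Lp_norm_infinity subspace_add subspace_scale)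
next
  case False
  then obtain r where r: "p = ereal r" "1 \<le> r" using p by (cases p) auto
  have Lp: "Lp_norm G p v = (\<integral>z. \<bar>v z\<bar> powr r \<partial>lebesgue_on G) powr (1 / r)" for v
    using r by (simp add: Lp_norm_def)
  show ?thesis
  proof
    show "subspace (C0 (closure G))" by (rule subspace_C0)
    show "Lp_norm G p v = 0 \<longleftrightarrow> v = 0" if v: "v \<in> C0 (closure G)" for v
    proof
      assume "Lp_norm G p v = 0"
      then have "(\<integral>z. \<bar>v z\<bar> powr r \<partial>lebesgue_on G) = 0" by (simp add: Lp)
      then have "AE z in lebesgue_on G. \<bar>v z\<bar> powr r = 0"
        using v r by (subst (asm) integral_nonneg_eq_0_iff_AE) (auto intro: C0_powr_integrable)
      then have "AE z in lebesgue_on G. v z \<in> {0}" by simp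
      then have "v z = 0" if "z \<in> closure G" for z
        using C0_AE_imp_closure[OF v _ _ that, of "{0}"] by simp
      with v show "v = 0" by (auto simp: C0_def fun_eq_iff zero_fun_def)
    qed (simp add: Lp zero_fun_def)
    show "Lp_norm G p (v + w) \<le> Lp_norm G p v + Lp_norm G p w"
      if "v \<in> C0 (closure G)" "w \<in> C0 (closure G)" for v w
      unfolding Lp plus_fun_def using that r
      by (intro Minkowski_integral_inequality C0_measurable C0_powr_integrable) auto
    show "Lp_norm G p (c *\<^sub>R v) = \<bar>c\<bar> * Lp_norm G p v" for c v
      using r by (simp add: Lp[unfolded r(1)] scaleR_fun_def abs_mult powr_mult powr_powr)
  qed
qed

end

section \<open>Bounded continuous inputs\<close>

lemma (in normed_linear_space) nrm_nonneg:
  assumes "v \<in> V"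
  shows "0 \<le> nrm v"
proof -
  have "(-1) *\<^sub>R v \<in> V" using subspace assms by (rule subspace_scale)
  from nrm_triangle[OF assms this] have "nrm 0 \<le> 2 * nrm v"
    using nrm_scaleR[OF assms, of "-1"] by simp
  moreover have "nrm 0 = 0" using nrm_eq_0[of 0] subspace by (simp add: subspace_0)
  ultimately show ?thesis by simp
qed

lemma normed_linear_space_subspace:
  assumes "normed_linear_space V nrm" "subspace W" "W \<subseteq> V"
  shows "normed_linear_space W nrm"
proof -
  interpret V: normed_linear_space V nrm by fact
  show ?thesis
    by unfold_locales
      (use assms(2,3) in \<open>auto simp: subset_iff V.nrm_eq_0 V.nrm_triangle V.nrm_scaleR\<close>)
qed

context bounded_region begin

lemma input_space_zero:
  assumes "u \<in> input_space G" "\<not> (0 \<le> t \<and> z \<in> frontier G)"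
  shows "u t z = 0"
  using assms by (cases "0 \<le> t") (simp_all add: input_space_def C0_def)

lemma input_bounded:
  assumes "u \<in> input_space G"
  shows "bdd_above ((\<lambda>s. \<bar>case s of (t, z) \<Rightarrow> u t z\<bar>) ` ({0..} \<times> frontier G))"
proof -
  obtain M where M: "\<And>t. t \<ge> 0 \<Longrightarrow> sup_norm (frontier G) (u t) \<le> M"
    and C: "\<And>t. t \<ge> 0 \<Longrightarrow> u t \<in> C0 (frontier G)"
    using assms by (auto simp: input_space_def)
  have "\<bar>u t z\<bar> \<le> M" if "t \<ge> 0" "z \<in> frontier G" for t z
    using sup_norm_upper[OF C0_bounded[OF C compact_frontier_region]] M that
    by (meson order_trans)
  then show ?thesis by (auto intro!: bdd_aboveI[of _ M])
qed

lemma input_norm_eq: "input_norm G u = sup_norm ({0..} \<times> frontier G) (\<lambda>(t, z). u t z)"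
  by (simp add: input_norm_def sup_norm_def split_def)

lemma input_norm_upper:
  assumes "u \<in> input_space G" "t \<ge> 0" "z \<in> frontier G"
  shows "\<bar>u t z\<bar> \<le> input_norm G u"
  using sup_norm_upper[OF input_bounded[OF assms(1)], of "(t, z)"] assms by (simp add: input_norm_eq)

lemma input_norm_const:
  assumes "\<And>t z. t \<ge> 0 \<Longrightarrow> z \<in> frontier G \<Longrightarrow> u t z = c"
  shows "input_norm G u = \<bar>c\<bar>"
proof -
  have "input_norm G u = (SUP (t, z) \<in> {0::real..} \<times> frontier G. \<bar>c\<bar>)"
    unfolding input_norm_def using assms by (intro SUP_cong) auto
  then show ?thesis using frontier_nonempty by (simp add: split_def)
qed

sublocale boundary: normed_linear_space "C0 (frontier G)" "sup_norm (frontier G)"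
  by (intro normed_linear_space_C0 compact_frontier_region frontier_nonempty)

lemma subspace_input_space: "subspace (input_space G)"
  unfolding subspace_def
proof (intro conjI ballI allI)
  show "0 \<in> input_space G"
    using frontier_nonempty boundary.subspace
    by (auto simp: input_space_def subspace_0 sup_norm_def zero_fun_def C0_def)
next
  fix u v assume u: "u \<in> input_space G" and v: "v \<in> input_space G"
  have C: "u t \<in> C0 (frontier G)" "v t \<in> C0 (frontier G)" if "t \<ge> 0" for t
    using u v that by (auto simp: input_space_def)
  have "((\<lambda>s. sup_norm (frontier G) ((u + v) s - (u + v) t)) \<longlongrightarrow> 0) (at t within {0..})"
    if t: "t \<ge> 0" for t
  proof (rule Lim_null_comparison)
    show "((\<lambda>s. sup_norm (frontier G) (u s - u t) + sup_norm (frontier G) (v s - v t)) \<longlongrightarrow> 0) (at t within {0..})"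
      using u v t by (intro tendsto_add_zero) (auto simp: input_space_def)
    show "\<forall>\<^sub>F s in at t within {0..}. norm (sup_norm (frontier G) ((u + v) s - (u + v) t)) \<le>
       sup_norm (frontier G) (u s - u t) + sup_norm (frontier G) (v s - v t)"
      unfolding eventually_at_filter
    proof (intro always_eventually allI impI)
      fix s :: real assume "s \<in> {0..}"
      then have D: "u s - u t \<in> C0 (frontier G)" "v s - v t \<in> C0 (frontier G)"
        using C t by (auto intro!: subspace_diff boundary.subspace)
      have eq: "(u + v) s - (u + v) t = (u s - u t) + (v s - v t)" by simp
      show "norm (sup_norm (frontier G) ((u + v) s - (u + v) t)) \<le>
         sup_norm (frontier G) (u s - u t) + sup_norm (frontier G) (v s - v t)"
        unfolding eq using boundary.nrm_triangle[OF D] boundary.nrm_nonneg[OF subspace_add[OF boundary.subspace D]]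
        by simp
    qed
  qed
  moreover obtain M1 M2 where
    "\<And>t. t \<ge> 0 \<Longrightarrow> sup_norm (frontier G) (u t) \<le> M1" "\<And>t. t \<ge> 0 \<Longrightarrow> sup_norm (frontier G) (v t) \<le> M2"
    using u v unfolding input_space_def by blast
  then have "\<forall>t\<ge>0. sup_norm (frontier G) ((u + v) t) \<le> M1 + M2"
    using boundary.nrm_triangle[OF C] by (fastforce simp: plus_fun_apply)
  moreover have "(u + v) t \<in> C0 (frontier G)" if "t \<ge> 0" for t
    using C[OF that] boundary.subspace by (simp add: subspace_add)
  ultimately show "u + v \<in> input_space G"
    using u v by (auto simp: input_space_def)
next
  fix c and u assume u: "u \<in> input_space G"
  have C: "u t \<in> C0 (frontier G)" if "t \<ge> 0" for t
    using u that by (auto simp: input_space_def)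
  have app: "(c *\<^sub>R u) t = c *\<^sub>R u t" for t by (simp add: scaleR_fun_def)
  have "((\<lambda>s. sup_norm (frontier G) ((c *\<^sub>R u) s - (c *\<^sub>R u) t)) \<longlongrightarrow> 0) (at t within {0..})"
    if t: "t \<ge> 0" for t
  proof (rule Lim_transform_eventually)
    show "((\<lambda>s. \<bar>c\<bar> * sup_norm (frontier G) (u s - u t)) \<longlongrightarrow> 0) (at t within {0..})"
      using u t by (intro tendsto_mult_right_zero) (auto simp: input_space_def)
    show "\<forall>\<^sub>F s in at t within {0..}. \<bar>c\<bar> * sup_norm (frontier G) (u s - u t) =
        sup_norm (frontier G) ((c *\<^sub>R u) s - (c *\<^sub>R u) t)"
      unfolding eventually_at_filter
    proof (intro always_eventually allI impI)
      fix s :: real assume "s \<in> {0..}"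
      then have D: "u s - u t \<in> C0 (frontier G)"
        using C t by (auto intro!: subspace_diff boundary.subspace)
      show "\<bar>c\<bar> * sup_norm (frontier G) (u s - u t) = sup_norm (frontier G) ((c *\<^sub>R u) s - (c *\<^sub>R u) t)"
        using boundary.nrm_scaleR[OF D] by (simp add: app scaleR_diff_right)
    qed
  qed
  moreover obtain M where "\<And>t. t \<ge> 0 \<Longrightarrow> sup_norm (frontier G) (u t) \<le> M"
    using u unfolding input_space_def by blast
  then have "\<forall>t\<ge>0. sup_norm (frontier G) ((c *\<^sub>R u) t) \<le> \<bar>c\<bar> * M"
    using boundary.nrm_scaleR[OF C] by (auto simp: app mult_left_mono)
  moreover have "(c *\<^sub>R u) t \<in> C0 (frontier G)" if "t \<ge> 0" for t
    using C[OF that] boundary.subspace by (simp add: app subspace_scale)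
  ultimately show "c *\<^sub>R u \<in> input_space G"
    using u by (auto simp: input_space_def app)
qed

sublocale inputs: normed_linear_space "input_space G" "input_norm G"
proof -
  have "normed_linear_space (input_space G) (\<lambda>u. sup_norm ({0..} \<times> frontier G) (\<lambda>(t, z). u t z))"
  proof (rule normed_linear_space_sup_norm[OF subspace_input_space])
    show "{0::real..} \<times> frontier G \<noteq> {}" using frontier_nonempty by auto
    show "u = 0" if u: "u \<in> input_space G" and "\<And>s. s \<in> {0..} \<times> frontier G \<Longrightarrow> (case s of (t, z) \<Rightarrow> u t z) = 0" for u
    proof (intro ext)
      fix t z
      show "u t z = 0 t z"
        using input_space_zero[OF u] that(2)[of "(t, z)"]
        by (cases "0 \<le> t \<and> z \<in> frontier G") simp_all
    qed
  qed (auto simp: input_bounded scaleR_fun_def)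
  then show "normed_linear_space (input_space G) (input_norm G)"
    by (simp add: input_norm_eq[abs_def])
qed

lemma time_shift_input_space:
  assumes u: "u \<in> input_space G" and \<tau>: "0 \<le> \<tau>"
  shows "time_shift \<tau> u \<in> input_space G"
proof -
  have "((\<lambda>s. sup_norm (frontier G) (time_shift \<tau> u s - time_shift \<tau> u t)) \<longlongrightarrow> 0) (at t within {0..})"
    if t: "t \<ge> 0" for t
  proof (rule Lim_transform_eventually)
    have "((\<lambda>s. sup_norm (frontier G) (u s - u (t + \<tau>))) \<longlongrightarrow> 0) (at (t + \<tau>) within {0..})"
      using u t \<tau> by (auto simp: input_space_def)
    moreover have "filterlim (\<lambda>s. s + \<tau>) (at (t + \<tau>) within {0..}) (at t within {0..})"
      unfolding filterlim_at using \<tau>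
      by (auto simp: eventually_at_filter intro!: tendsto_intros)
    ultimately show "((\<lambda>s. sup_norm (frontier G) (u (s + \<tau>) - u (t + \<tau>))) \<longlongrightarrow> 0) (at t within {0..})"
      by (rule filterlim_compose)
    show "\<forall>\<^sub>F s in at t within {0..}. sup_norm (frontier G) (u (s + \<tau>) - u (t + \<tau>)) =
       sup_norm (frontier G) (time_shift \<tau> u s - time_shift \<tau> u t)"
      using t by (auto simp: eventually_at_filter time_shift_def)
  qed
  moreover obtain M where "\<And>t. t \<ge> 0 \<Longrightarrow> sup_norm (frontier G) (u t) \<le> M"
    using u unfolding input_space_def by blast
  then have "\<forall>t\<ge>0. sup_norm (frontier G) (time_shift \<tau> u t) \<le> M"
    using \<tau> by (simp add: time_shift_def)
  moreover have "time_shift \<tau> u t \<in> C0 (frontier G)" if "t \<ge> 0" for t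
    using u \<tau> that by (simp add: input_space_def time_shift_def)
  moreover have "time_shift \<tau> u t = 0" if "t < 0" for t
    using that by (simp add: time_shift_def)
  ultimately show ?thesis
    unfolding input_space_def by blast
qed

end

section \<open>Time invariance of the boundary value problem\<close>

lemma continuous_on_time_shift:
  fixes h :: "real \<Rightarrow> 'a::topological_space \<Rightarrow> real"
  assumes "continuous_on (I \<times> S) (\<lambda>(t, z). h t z)"
    and "\<And>t. t \<in> I \<Longrightarrow> t + \<tau> \<in> I"
    and "\<And>t z. t \<in> I \<Longrightarrow> z \<in> S \<Longrightarrow> g t z = h (t + \<tau>) z"
  shows "continuous_on (I \<times> S) (\<lambda>(t, z). g t z)"
proof -
  have "continuous_on (I \<times> S) (\<lambda>s. (\<lambda>(t, z). h t z) (fst s + \<tau>, snd s))"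
    by (rule continuous_on_compose2[OF assms(1)]) (use assms(2) in \<open>auto intro!: continuous_intros\<close>)
  then show ?thesis
    by (rule continuous_on_eq) (auto simp: assms(3))
qed

lemma partial_t_time_shift:
  fixes x :: "real \<Rightarrow> real^'n \<Rightarrow> real"
  assumes x: "C12 G x" and \<tau>: "0 \<le> \<tau>" and s: "0 < s" and z: "z \<in> G"
  shows "((\<lambda>s. time_shift \<tau> x s z) has_real_derivative partial_t x (s + \<tau>) z) (at s)"
proof (rule has_field_derivative_transform_within_open)
  show "((\<lambda>s. x (s + \<tau>) z) has_real_derivative partial_t x (s + \<tau>) z) (at s)"
    using C12_partials(3)[OF x _ z, of "s + \<tau>"] \<tau> s by (simp add: DERIV_shift)
  show "open {0::real<..}" "s \<in> {0<..}" using s by auto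
qed (simp add: time_shift_def)

lemma time_shift_CL:
  fixes x :: "real \<Rightarrow> real^'n \<Rightarrow> real"
  assumes x: "x \<in> CL G" and \<tau>: "0 \<le> \<tau>"
  shows "time_shift \<tau> x \<in> CL G"
proof -
  have C12: "C12 G x" using x by (simp add: CL_def)
  have sh: "time_shift \<tau> x s = x (s + \<tau>)" if "0 \<le> s" for s
    using that by (simp add: time_shift_def)
  note D = partial_t_time_shift[OF C12 \<tau>]
  have pt: "partial_t (time_shift \<tau> x) s z = partial_t x (s + \<tau>) z" if "0 < s" "z \<in> G" for s z
    unfolding partial_t_def[of "time_shift \<tau> x"] using D[OF that] by (rule DERIV_imp_deriv)
  have "C12 G (time_shift \<tau> x)"
    unfolding C12_def
  proof (intro conjI allI impI ballI)
    fix t :: real and z i j assume t: "0 < t" and z: "z \<in> G"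
    show "(\<lambda>s. time_shift \<tau> x s z) differentiable at t"
      using D[OF t z] by (auto simp: real_differentiable_def)
    show "has_partial_z i (time_shift \<tau> x t) z" "has_partial_z i (partial_z j (time_shift \<tau> x t)) z"
      using C12 t z \<tau> by (auto simp: C12_def sh)
  next
    fix i j
    note c = C12[unfolded C12_def]
    show "continuous_on ({0<..} \<times> G) (\<lambda>(t, z). time_shift \<tau> x t z)"
      by (rule continuous_on_time_shift[where \<tau>=\<tau> and h=x]) (use c \<tau> in \<open>auto simp: sh\<close>)
    show "continuous_on ({0<..} \<times> G) (\<lambda>(t, z). partial_t (time_shift \<tau> x) t z)"
      by (rule continuous_on_time_shift[where \<tau>=\<tau> and h="partial_t x"]) (use c \<tau> in \<open>auto simp: pt\<close>)
    show "continuous_on ({0<..} \<times> G) (\<lambda>(t, z). partial_z i (time_shift \<tau> x t) z)"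
      by (rule continuous_on_time_shift[where \<tau>=\<tau> and h="\<lambda>t. partial_z i (x t)"]) (use c \<tau> in \<open>auto simp: sh\<close>)
    show "continuous_on ({0<..} \<times> G) (\<lambda>(t, z). partial_z i (partial_z j (time_shift \<tau> x t)) z)"
      by (rule continuous_on_time_shift[where \<tau>=\<tau> and h="\<lambda>t. partial_z i (partial_z j (x t))"])
        (use c \<tau> in \<open>auto simp: sh\<close>)
  qed
  moreover have "continuous_on ({0..} \<times> closure G) (\<lambda>(t, z). time_shift \<tau> x t z)"
    by (rule continuous_on_time_shift[where \<tau>=\<tau> and h=x]) (use x \<tau> in \<open>auto simp: sh CL_def\<close>)
  moreover have "\<forall>t z. \<not> (0 \<le> t \<and> z \<in> closure G) \<longrightarrow> time_shift \<tau> x t z = 0"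
    using x by (auto simp: CL_def time_shift_def)
  ultimately show ?thesis by (simp add: CL_def)
qed

text \<open>
  The problem is autonomous. This gives the cocycle property, as the shifted solution is the unique
  solution starting at \<open>x \<tau>\<close>.
\<close>

lemma ibvp_solution_time_shift:
  fixes x :: "real \<Rightarrow> real^'n \<Rightarrow> real"
  assumes sol: "ibvp_solution G a f x0 u x" and \<tau>: "0 \<le> \<tau>"
  shows "ibvp_solution G a f (x \<tau>) (time_shift \<tau> u) (time_shift \<tau> x)"
proof -
  have x: "x \<in> CL G" and C12: "C12 G x" using sol by (auto simp: ibvp_solution_def CL_def)
  have "L_op a f (time_shift \<tau> x) t z = L_op a f x (t + \<tau>) z" if "0 < t" "z \<in> G" for t z
    using that DERIV_imp_deriv[OF partial_t_time_shift[OF C12 \<tau> that]]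
    by (simp add: L_op_def partial_t_def[of "time_shift \<tau> x"]) (simp add: time_shift_def)
  then show ?thesis
    using sol \<tau> time_shift_CL[OF x \<tau>] by (simp add: ibvp_solution_def time_shift_def)
qed

section \<open>Solutions as a monotone control system\<close>

locale parabolic_problem = bounded_region G
  for G :: "(real^'n) set" +
  fixes a :: "'n \<Rightarrow> 'n \<Rightarrow> real^'n \<Rightarrow> real" and f :: "real^'n \<Rightarrow> real \<Rightarrow> real^'n \<Rightarrow> real"
    and X :: "(real^'n \<Rightarrow> real) set" and Uad :: "(real^'n \<Rightarrow> real) \<Rightarrow> (real \<Rightarrow> real^'n \<Rightarrow> real) set"
  assumes par: "uniformly_parabolic G a" and H1: "H1 G a f X Uad" and H2: "H2 G f"
begin

lemma subspace_X: "subspace X" and X_C0: "X \<subseteq> C0 (closure G)"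
  using H1 unfolding H1_def by blast+

lemma Uad_input_space: "x0 \<in> X \<Longrightarrow> u \<in> Uad x0 \<Longrightarrow> u \<in> input_space G"
  using H1 unfolding H1_def by blast

lemma Uad_compatible: "x0 \<in> X \<Longrightarrow> u \<in> Uad x0 \<Longrightarrow> z \<in> frontier G \<Longrightarrow> u 0 z = x0 z"
  using H1 unfolding H1_def by blast

lemma constant_input_admissible:
  assumes "x0 \<in> X" "\<And>z. z \<in> frontier G \<Longrightarrow> x0 z = c"
  shows "(\<lambda>t. if 0 \<le> t then restr0 (frontier G) x0 else 0) \<in> Uad x0"
proof -
  have "\<forall>x0\<in>X. (\<exists>c. \<forall>z\<in>frontier G. x0 z = c) \<longrightarrow>
     (\<lambda>t. if 0 \<le> t then restr0 (frontier G) x0 else 0) \<in> Uad x0"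
    using H1 unfolding H1_def by (elim conjE)
  with assms show ?thesis by simp
qed

lemma solution_comparison:
  assumes x: "ibvp_solution G a f x0 u x" and y: "ibvp_solution G a f y0 v y"
    and "\<And>z. z \<in> G \<Longrightarrow> x0 z \<le> y0 z"
    and "\<And>s z. 0 \<le> s \<Longrightarrow> s \<le> t \<Longrightarrow> z \<in> frontier G \<Longrightarrow> u s z \<le> v s z"
    and t: "0 \<le> t"
  shows "state_le G (x t) (y t)"
  unfolding state_le_def
proof
  fix z assume z: "z \<in> closure G"
  have CL: "x \<in> CL G" "y \<in> CL G"
    and L: "\<And>s z. 0 < s \<Longrightarrow> z \<in> G \<Longrightarrow> L_op a f x s z = 0" "\<And>s z. 0 < s \<Longrightarrow> z \<in> G \<Longrightarrow> L_op a f y s z = 0"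
    and init: "\<And>z. z \<in> G \<Longrightarrow> x 0 z = x0 z" "\<And>z. z \<in> G \<Longrightarrow> y 0 z = y0 z"
    and bdry: "\<And>s z. 0 \<le> s \<Longrightarrow> z \<in> frontier G \<Longrightarrow> x s z = u s z"
      "\<And>s z. 0 \<le> s \<Longrightarrow> z \<in> frontier G \<Longrightarrow> y s z = v s z"
    using x y by (simp_all add: ibvp_solution_def)
  show "x t z \<le> y t z"
    by (rule parabolic_comparison[where T=t, OF G(1,2) par H2 CL])
      (simp_all add: L init bdry assms(3,4) t z)
qed

lemma state_le_antisym:
  "v \<in> C0 (closure G) \<Longrightarrow> w \<in> C0 (closure G) \<Longrightarrow> state_le G v w \<Longrightarrow> state_le G w v \<Longrightarrow> v = w"
proof
  fix z
  assume "v \<in> C0 (closure G)" "w \<in> C0 (closure G)" "state_le G v w" "state_le G w v"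
  then show "v z = w z"
    by (cases "z \<in> closure G") (simp_all add: C0_def state_le_def order_antisym)
qed

lemma solution_C0:
  assumes "ibvp_solution G a f x0 u x" "0 \<le> t"
  shows "x t \<in> C0 (closure G)"
proof -
  have "continuous_on ({0..} \<times> closure G) (\<lambda>(t, z). x t z)"
    using assms by (simp add: ibvp_solution_def CL_def)
  then have "continuous_on (closure G) (\<lambda>z. (\<lambda>(t, z). x t z) (t, z))"
    by (rule continuous_on_compose2) (use assms(2) in \<open>auto intro!: continuous_intros\<close>)
  then show ?thesis
    using assms by (auto simp: C0_def ibvp_solution_def CL_def)
qed

text \<open>
  Comparing in both directions on the time interval from 0 to \<open>t\<close> only uses the inputs on that
  interval, so uniqueness and causality are obtained together.
\<close>

lemma solution_unique:
  assumes x: "ibvp_solution G a f x0 u x" and y: "ibvp_solution G a f x0 v y"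
    and uv: "\<And>s. 0 \<le> s \<Longrightarrow> s \<le> t \<Longrightarrow> u s = v s" and t: "0 \<le> t"
  shows "x t = y t"
proof (rule state_le_antisym)
  show "state_le G (x t) (y t)" by (rule solution_comparison[OF x y]) (use uv t in auto)
  show "state_le G (y t) (x t)" by (rule solution_comparison[OF y x]) (use uv t in auto)
qed (use x y t in \<open>auto intro: solution_C0\<close>)

lemma solution_ex1:
  assumes "x0 \<in> X" "u \<in> Uad x0"
  shows "\<exists>!x. ibvp_solution G a f x0 u x"
proof -
  have "x = y" if x: "ibvp_solution G a f x0 u x" and y: "ibvp_solution G a f x0 u y" for x y
  proof
    fix t
    show "x t = y t"
    proof (cases "0 \<le> t")
      case True
      then show ?thesis using x y by (intro solution_unique) auto
    next
      case False
      then show ?thesis using x y by (auto simp: ibvp_solution_def CL_def fun_eq_iff)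
    qed
  qed
  moreover have "\<exists>x. ibvp_solution G a f x0 u x"
    using assms H1 unfolding H1_def by blast
  ultimately show ?thesis by blast
qed

lemma solution_map_eq:
  assumes "x0 \<in> X" "u \<in> Uad x0" "ibvp_solution G a f x0 u x"
  shows "solution_map G a f t x0 u = x t"
proof -
  have "(THE x. ibvp_solution G a f x0 u x) = x"
    by (rule the1_equality[OF solution_ex1[OF assms(1,2)]]) (rule assms(3))
  then show ?thesis by (simp add: solution_map_def)
qed

lemma obtain_solution:
  assumes "x0 \<in> X" "u \<in> Uad x0"
  obtains x where "ibvp_solution G a f x0 u x" "\<And>t. 0 \<le> t \<Longrightarrow> x t \<in> X"
    "\<And>t. solution_map G a f t x0 u = x t"
proof -
  obtain x where "ibvp_solution G a f x0 u x" "\<forall>t\<ge>0. x t \<in> X"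
    using assms H1 unfolding H1_def by blast
  then show ?thesis using that solution_map_eq[OF assms] by blast
qed

text \<open>
  The initial condition prescribes the solution on the open region only; on the frontier its initial
  value is that of the input, and admissible inputs are compatible with \<open>x0\<close> there.
\<close>

lemma solution_initial:
  assumes "x0 \<in> X" "u \<in> Uad x0" "ibvp_solution G a f x0 u x"
  shows "x 0 = x0"
proof
  fix z
  have "x 0 \<in> C0 (closure G)" using assms(3) by (rule solution_C0) simp
  moreover have "x0 \<in> C0 (closure G)" using assms(1) X_C0 by blast
  moreover have "x 0 z = x0 z" if "z \<in> closure G"
    using that Uad_compatible[OF assms(1,2)] assms(3)
    by (cases rule: closure_cases) (auto simp: ibvp_solution_def)
  ultimately show "x 0 z = x0 z" by (cases "z \<in> closure G") (auto simp: C0_def)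
qed

lemma normed_linear_space_X:
  assumes "1 \<le> p"
  shows "normed_linear_space X (Lp_norm G p)"
  using normed_linear_space_Lp[OF assms] subspace_X X_C0 by (rule normed_linear_space_subspace)

text \<open>
  Causality is the local form of uniqueness, the cocycle property is time invariance together with
  uniqueness, and monotonicity is the comparison principle.
\<close>

lemma monotone_control_system_ibvp:
  assumes p: "1 \<le> p" and adm: "admissible_family G a f X Uad"
  shows "monotone_control_system X (Lp_norm G p) (state_le G)
          (C0 (frontier G)) (sup_norm (frontier G))
          (input_space G) (input_norm G) (input_le G)
          (C0 (frontier G)) Uad (solution_map G a f)"
proof -
  interpret X: normed_linear_space X "Lp_norm G p" using p by (rule normed_linear_space_X)
  let ?\<phi> = "solution_map G a f"
  show ?thesis
  proof unfold_locales
    show "C0 (frontier G) \<noteq> {}" using subspace_0[OF boundary.subspace] by blast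
    show "u t \<in> C0 (frontier G)" if "u \<in> input_space G" "0 \<le> t" for u t
      using that by (simp add: input_space_def)
    show "u t = 0" if "u \<in> input_space G" "t < 0" for u and t :: real
      using that by (simp add: input_space_def)
    show "Uad x \<noteq> {}" if "x \<in> X" for x
      using that adm by (simp add: admissible_family_def)
    show "Uad x \<subseteq> input_space G" if "x \<in> X" for x
      using that Uad_input_space by blast
    show "?\<phi> t x u \<in> X" if "x \<in> X" "u \<in> Uad x" "0 \<le> t" for t x u
      using that by (elim obtain_solution) auto
    show "?\<phi> 0 x u = x" if xu: "x \<in> X" "u \<in> Uad x" for x u
      using obtain_solution[OF xu] solution_initial[OF xu] by metis
    show "?\<phi> t x u = ?\<phi> t x u'"
      if xu: "x \<in> X" "u \<in> Uad x" "u' \<in> Uad x" "0 \<le> t" "\<forall>s\<in>{0..t}. u s = u' s" for t x u u'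
      by (rule obtain_solution[OF xu(1,2)], rule obtain_solution[OF xu(1,3)])
        (use xu(4,5) in \<open>auto intro: solution_unique\<close>)
    show shift: "time_shift t u \<in> Uad (?\<phi> t x u)" if xu: "x \<in> X" "u \<in> Uad x" "0 \<le> t" for t x u
      by (rule obtain_solution[OF xu(1,2)]) (use xu adm in \<open>auto simp: admissible_family_def\<close>)
    show "?\<phi> h (?\<phi> t x u) (time_shift t u) = ?\<phi> (t + h) x u"
      if xu: "x \<in> X" "u \<in> Uad x" "0 \<le> t" "0 \<le> h" for t h x u
    proof -
      obtain y where y: "ibvp_solution G a f x u y" "\<And>t. 0 \<le> t \<Longrightarrow> y t \<in> X" "\<And>t. ?\<phi> t x u = y t"
        using obtain_solution[OF xu(1,2)] by blast
      have "?\<phi> h (y t) (time_shift t u) = time_shift t y h"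
        using shift[OF xu(1-3)] y xu by (intro solution_map_eq ibvp_solution_time_shift[OF y(1)]) auto
      then show ?thesis using xu y(3) by (simp add: time_shift_def add.commute)
    qed
    show "state_le G (?\<phi> t x1 u1) (?\<phi> t x2 u2)"
      if xu: "x1 \<in> X" "x2 \<in> X" "u1 \<in> Uad x1" "u2 \<in> Uad x2" "state_le G x1 x2" "input_le G u1 u2" "0 \<le> t"
      for t x1 x2 u1 u2
      by (rule obtain_solution[OF xu(1,3)], rule obtain_solution[OF xu(2,4)])
        (use xu(5-7) region_subset in \<open>auto simp: state_le_def[of G x1] input_le_def intro!: solution_comparison\<close>)
    show "input_le G u w" if "input_le G u v" "input_le G v w" for u v w
      using that unfolding input_le_def by (meson order_trans)
    show "v = w" if "v \<in> X" "w \<in> X" "state_le G v w" "state_le G w v" for v w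
      using that X_C0 state_le_antisym by blast
    show "u = v" if uv: "u \<in> input_space G" "v \<in> input_space G" "input_le G u v" "input_le G v u" for u v
    proof (intro ext)
      fix t z
      show "u t z = v t z"
        using uv(3,4) input_space_zero[OF uv(1)] input_space_zero[OF uv(2)]
        by (cases "0 \<le> t \<and> z \<in> frontier G") (simp_all add: input_le_def order_antisym)
    qed
  qed (auto simp: state_le_def input_le_def scaleR_fun_def mult_left_mono time_shift_input_space
      intro: order_trans)
qed

section \<open>Bracketing by constant inputs\<close>

lemma Lp_norm_order_bounds:
  assumes p: "1 \<le> p" and x: "x\<^sub>m \<in> X" "x \<in> X" "x\<^sub>p \<in> X"
    and le: "state_le G x\<^sub>m x" "state_le G x x\<^sub>p"
  shows "Lp_norm G p x \<le> Lp_norm G p x\<^sub>m + Lp_norm G p x\<^sub>p"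
proof -
  interpret Lp: normed_linear_space "C0 (closure G)" "Lp_norm G p"
    using p by (rule normed_linear_space_Lp)
  note C = x[THEN subsetD[OF X_C0]]
  note abs = C0_abs[OF C(1)] C0_abs[OF C(3)]
  have "Lp_norm G p x \<le> Lp_norm G p ((\<lambda>z. \<bar>x\<^sub>m z\<bar>) + (\<lambda>z. \<bar>x\<^sub>p z\<bar>))"
    using le by (intro Lp_norm_mono p C subspace_add subspace_C0 abs) (force simp: state_le_def)
  also have "\<dots> \<le> Lp_norm G p (\<lambda>z. \<bar>x\<^sub>m z\<bar>) + Lp_norm G p (\<lambda>z. \<bar>x\<^sub>p z\<bar>)"
    by (rule Lp.nrm_triangle[OF abs])
  also have "\<dots> \<le> Lp_norm G p x\<^sub>m + Lp_norm G p x\<^sub>p"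
    by (intro add_mono Lp_norm_mono p C abs) auto
  finally show ?thesis .
qed

text \<open>
  The cutoff of \<open>H3\<close> blends \<open>x\<close> into the constant \<open>c\<close> near the boundary, so that the constant
  input \<open>c\<close> becomes admissible. On the boundary \<open>x\<close> agrees with \<open>u 0\<close>; by uniform continuity it
  exceeds the norm of \<open>u\<close> by at most \<open>\<epsilon>\<close> in a boundary layer, and the cutoff is supported in that layer.
\<close>

lemma constant_boundary_state:
  assumes H3: "H3 G X" and x: "x \<in> X" and u: "u \<in> Uad x" and \<epsilon>: "\<epsilon> > 0"
  obtains y v where "y \<in> X" "v \<in> Uad y \<inter> const_inputs G"
    "\<And>t z. 0 \<le> t \<Longrightarrow> z \<in> frontier G \<Longrightarrow> v t z = c"
    "\<And>z. z \<in> closure G \<Longrightarrow> \<exists>k\<in>{0..1}. y z = (1 - k) * x z + c * k \<and>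
       (k = 0 \<or> \<bar>x z\<bar> \<le> input_norm G u + \<epsilon>)"
proof -
  have bdry: "\<bar>x z\<bar> \<le> input_norm G u" if "z \<in> frontier G" for z
    using input_norm_upper[OF Uad_input_space[OF x u] order_refl that] Uad_compatible[OF x u that] by simp
  have "uniformly_continuous_on (closure G) x"
    using x X_C0 compact_closure_region by (auto simp: C0_def intro!: compact_uniformly_continuous)
  then obtain \<delta> where \<delta>: "\<delta> > 0" and close:
    "\<And>z z'. z \<in> closure G \<Longrightarrow> z' \<in> closure G \<Longrightarrow> dist z' z < \<delta> \<Longrightarrow> dist (x z') (x z) < \<epsilon>"
    unfolding uniformly_continuous_on_def using \<epsilon> by metis
  have near: "\<bar>x z\<bar> \<le> input_norm G u + \<epsilon>" if "z \<in> closure G" "infdist z (frontier G) < \<delta>" for z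
  proof -
    obtain z' where z': "z' \<in> frontier G" "infdist z (frontier G) = dist z z'"
      using infdist_attains_inf[OF frontier_closed frontier_nonempty] by blast
    have "dist (x z) (x z') < \<epsilon>"
      using that z' frontier_subset by (intro close) auto
    then show ?thesis using bdry[OF z'(1)] by (simp add: dist_real_def)
  qed
  obtain k where k: "k ` closure G \<subseteq> {0..1}" "\<And>z. z \<in> frontier G \<Longrightarrow> k z = 1"
      "\<And>z. z \<in> G \<Longrightarrow> infdist z (frontier G) \<ge> \<delta> \<Longrightarrow> k z = 0"
    and y: "restr0 (closure G) (\<lambda>z. (1 - k z) * x z + c * k z) \<in> X" (is "?y \<in> X")
    using H3[unfolded H3_def, rule_format, OF \<delta> x, of c] by (elim exE conjE) blast
  let ?v = "\<lambda>t. if 0 \<le> t then restr0 (frontier G) ?y else (0 :: real^'n \<Rightarrow> real)"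
  have yc: "?y z = c" if "z \<in> frontier G" for z
    using that k(2) frontier_subset by (auto simp: restr0_def)
  have v: "?v \<in> Uad ?y"
    using y yc by (rule constant_input_admissible)
  have vc: "?v t z = c" if "0 \<le> t" "z \<in> frontier G" for t z
    using that yc[of z] by (simp add: restr0_def)
  show ?thesis
  proof (rule that[OF y])
    show "?v \<in> Uad ?y \<inter> const_inputs G"
      using v Uad_input_space[OF y v] vc unfolding const_inputs_def by blast
    show "?v t z = c" if "0 \<le> t" "z \<in> frontier G" for t z using that by (rule vc)
    show "\<exists>k\<in>{0..1}. ?y z = (1 - k) * x z + c * k \<and> (k = 0 \<or> \<bar>x z\<bar> \<le> input_norm G u + \<epsilon>)"
      if z: "z \<in> closure G" for z
    proof (intro bexI conjI)
      show "k z \<in> {0..1}" using k(1) z by blast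
      show "?y z = (1 - k z) * x z + c * k z" using z by (simp add: restr0_def)
      show "k z = 0 \<or> \<bar>x z\<bar> \<le> input_norm G u + \<epsilon>"
        using z
      proof (cases rule: closure_cases)
        case 1
        then show ?thesis using k(3) near[OF z] by fastforce
      next
        case 2
        then show ?thesis using bdry[of z] \<epsilon> by simp
      qed
    qed
  qed
qed

text \<open>
  The triangle inequality for \<open>\<bar>x\<bar>\<close> and the constant function \<open>c\<close>; the region is bounded, so the norm
  of the constant function 1 is finite and yields a linear bound.
\<close>

lemma Lp_norm_le_shifted:
  assumes p: "1 \<le> p" and x: "x \<in> C0 (closure G)" and y: "y \<in> C0 (closure G)" and c: "0 \<le> c"
    and le: "\<And>z. z \<in> closure G \<Longrightarrow> \<bar>y z\<bar> \<le> \<bar>x z\<bar> + c"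
  shows "Lp_norm G p y \<le> (1 + Lp_norm G p (restr0 (closure G) (\<lambda>_. 1))) * (Lp_norm G p x + c)"
proof -
  interpret Lp: normed_linear_space "C0 (closure G)" "Lp_norm G p"
    using p by (rule normed_linear_space_Lp)
  let ?one = "restr0 (closure G) (\<lambda>_. 1)"
  have "continuous_on (closure G) ?one"
    by (rule continuous_on_eq[of _ "\<lambda>_. 1"]) (auto simp: restr0_def)
  then have one: "?one \<in> C0 (closure G)" by (simp add: C0_def restr0_def)
  note abs = C0_abs[OF x]
  have c1: "c *\<^sub>R ?one \<in> C0 (closure G)" by (intro subspace_scale subspace_C0 one)
  have "Lp_norm G p y \<le> Lp_norm G p ((\<lambda>z. \<bar>x z\<bar>) + c *\<^sub>R ?one)"
    using le by (intro Lp_norm_mono p y subspace_add subspace_C0 abs c1) (fastforce simp: scaleR_fun_def restr0_def)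
  also have "\<dots> \<le> Lp_norm G p (\<lambda>z. \<bar>x z\<bar>) + Lp_norm G p (c *\<^sub>R ?one)"
    by (rule Lp.nrm_triangle[OF abs c1])
  also have "Lp_norm G p (c *\<^sub>R ?one) = c * Lp_norm G p ?one"
    using Lp.nrm_scaleR[OF one] c by simp
  also have "Lp_norm G p (\<lambda>z. \<bar>x z\<bar>) \<le> Lp_norm G p x"
    by (intro Lp_norm_mono p x abs) auto
  also have "Lp_norm G p x + c * Lp_norm G p ?one \<le> (1 + Lp_norm G p ?one) * (Lp_norm G p x + c)"
    using Lp.nrm_nonneg[OF x] Lp.nrm_nonneg[OF one] c by (simp add: algebra_simps)
  finally show ?thesis by simp
qed

text \<open>
  The constants are \<open>c = \<parallel>u\<parallel> + \<epsilon>\<close> and \<open>- c\<close>. A state blended with \<open>c\<close> lies above \<open>x\<close>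
  because \<open>\<bar>x\<bar> \<le> c\<close> wherever the cutoff is nonzero, and its modulus is at most \<open>\<bar>x\<bar> + c\<close>.
\<close>

lemma constant_input_bracket:
  assumes H3: "H3 G X" and p: "1 \<le> p" and x: "x \<in> X" and u: "u \<in> Uad x" and \<epsilon>: "\<epsilon> > 0"
  shows "\<exists>x\<^sub>m\<in>X. \<exists>x\<^sub>p\<in>X. \<exists>u\<^sub>m \<in> Uad x\<^sub>m \<inter> const_inputs G. \<exists>u\<^sub>p \<in> Uad x\<^sub>p \<inter> const_inputs G.
     state_le G x\<^sub>m x \<and> state_le G x x\<^sub>p \<and> input_le G u\<^sub>m u \<and> input_le G u u\<^sub>p \<and>
     max (input_norm G u\<^sub>m) (input_norm G u\<^sub>p) \<le> input_norm G u + \<epsilon> \<and>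
     max (Lp_norm G p x\<^sub>m) (Lp_norm G p x\<^sub>p) \<le>
       (1 + Lp_norm G p (restr0 (closure G) (\<lambda>_. 1))) * (Lp_norm G p x + input_norm G u + \<epsilon>)"
proof -
  define c where "c = input_norm G u + \<epsilon>"
  note uI = Uad_input_space[OF x u]
  have c: "0 \<le> c" using inputs.nrm_nonneg[OF uI] \<epsilon> by (simp add: c_def)
  have ule: "\<bar>u t z\<bar> \<le> c" if "t \<ge> 0" "z \<in> frontier G" for t z
    using input_norm_upper[OF uI that] \<epsilon> by (simp add: c_def)
  note xC = subsetD[OF X_C0 x]
  have Lp: "Lp_norm G p y \<le> (1 + Lp_norm G p (restr0 (closure G) (\<lambda>_. 1))) * (Lp_norm G p x + c)"
    if y: "y \<in> X" and b: "\<bar>b\<bar> = c" and conv: "\<And>z. z \<in> closure G \<Longrightarrow> \<exists>k\<in>{0..1}. y z = (1 - k) * x z + b * k \<and>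
       (k = 0 \<or> \<bar>x z\<bar> \<le> c)" for y b
  proof (rule Lp_norm_le_shifted[OF p xC subsetD[OF X_C0 y] c])
    fix z assume "z \<in> closure G"
    from conv[OF this] obtain k where k: "k \<in> {0..1}" "y z = (1 - k) * x z + b * k" by blast
    have "\<bar>y z\<bar> \<le> \<bar>(1 - k) * x z\<bar> + \<bar>b * k\<bar>"
      unfolding k(2) by (rule abs_triangle_ineq)
    also have "\<dots> = (1 - k) * \<bar>x z\<bar> + \<bar>b\<bar> * k"
      using k(1) by (simp add: abs_mult)
    also have "\<dots> \<le> 1 * \<bar>x z\<bar> + \<bar>b\<bar> * 1"
      using k(1) by (intro add_mono mult_right_mono mult_left_mono) auto
    finally show "\<bar>y z\<bar> \<le> \<bar>x z\<bar> + c" using b by simp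
  qed
  obtain x\<^sub>p u\<^sub>p where P: "x\<^sub>p \<in> X" "u\<^sub>p \<in> Uad x\<^sub>p \<inter> const_inputs G"
    "\<And>t z. 0 \<le> t \<Longrightarrow> z \<in> frontier G \<Longrightarrow> u\<^sub>p t z = c"
    "\<And>z. z \<in> closure G \<Longrightarrow> \<exists>k\<in>{0..1}. x\<^sub>p z = (1 - k) * x z + c * k \<and> (k = 0 \<or> \<bar>x z\<bar> \<le> c)"
    using constant_boundary_state[OF H3 x u \<epsilon>, of c] unfolding c_def by metis
  obtain x\<^sub>m u\<^sub>m where M: "x\<^sub>m \<in> X" "u\<^sub>m \<in> Uad x\<^sub>m \<inter> const_inputs G"
    "\<And>t z. 0 \<le> t \<Longrightarrow> z \<in> frontier G \<Longrightarrow> u\<^sub>m t z = - c"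
    "\<And>z. z \<in> closure G \<Longrightarrow> \<exists>k\<in>{0..1}. x\<^sub>m z = (1 - k) * x z + (- c) * k \<and> (k = 0 \<or> \<bar>x z\<bar> \<le> c)"
    using constant_boundary_state[OF H3 x u \<epsilon>, of "- c"] unfolding c_def by metis
  have "state_le G x x\<^sub>p"
    unfolding state_le_def
  proof
    fix z assume "z \<in> closure G"
    from P(4)[OF this] obtain k where k: "k \<in> {0..1}" "x\<^sub>p z = (1 - k) * x z + c * k"
      "k = 0 \<or> \<bar>x z\<bar> \<le> c" by blast
    have "0 \<le> k * (c - x z)" using k by auto
    then show "x z \<le> x\<^sub>p z" by (simp add: k(2) algebra_simps)
  qed
  moreover have "state_le G x\<^sub>m x"
    unfolding state_le_def
  proof
    fix z assume "z \<in> closure G"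
    from M(4)[OF this] obtain k where k: "k \<in> {0..1}" "x\<^sub>m z = (1 - k) * x z + (- c) * k"
      "k = 0 \<or> \<bar>x z\<bar> \<le> c" by blast
    have "0 \<le> k * (c + x z)" using k by auto
    then show "x\<^sub>m z \<le> x z" by (simp add: k(2) algebra_simps)
  qed
  moreover have "input_le G u u\<^sub>p" "input_le G u\<^sub>m u"
    using ule P(3) M(3) by (auto simp: input_le_def abs_le_iff) (metis minus_le_iff)
  moreover have "input_norm G u\<^sub>p = c" "input_norm G u\<^sub>m = c"
    using input_norm_const[OF P(3)] input_norm_const[OF M(3)] c by auto
  moreover have "Lp_norm G p x\<^sub>p \<le> (1 + Lp_norm G p (restr0 (closure G) (\<lambda>_. 1))) * (Lp_norm G p x + c)"
    "Lp_norm G p x\<^sub>m \<le> (1 + Lp_norm G p (restr0 (closure G) (\<lambda>_. 1))) * (Lp_norm G p x + c)"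
    using Lp[OF P(1) _ P(4)] Lp[OF M(1) _ M(4)] c by auto
  ultimately show ?thesis
    using P(1,2) M(1,2) by (intro bexI[of _ x\<^sub>m] bexI[of _ x\<^sub>p] bexI[of _ u\<^sub>m] bexI[of _ u\<^sub>p])
      (auto simp: c_def add.assoc)
qed

end

lemma class_Kinf_scale:
  assumes "c > 0"
  shows "class_Kinf (\<lambda>r. c * r)"
  unfolding class_Kinf_def
proof (intro conjI allI)
  fix M
  show "\<exists>r\<ge>0. M < c * r"
    using assms by (intro exI[of _ "(\<bar>M\<bar> + 1) / c"]) auto
qed (use assms in \<open>auto intro!: continuous_intros strict_mono_onI\<close>)

theorem mainTheorem3:
  fixes G :: "(real^'n) set"
    and a :: "'n \<Rightarrow> 'n \<Rightarrow> real^'n \<Rightarrow> real"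
    and f :: "real^'n \<Rightarrow> real \<Rightarrow> real^'n \<Rightarrow> real"
    and X :: "(real^'n \<Rightarrow> real) set"
    and Uad :: "(real^'n \<Rightarrow> real) \<Rightarrow> (real \<Rightarrow> real^'n \<Rightarrow> real) set"
    and p :: ereal
  assumes "open G" and "bounded G" and "G \<noteq> {}"
    and "\<And>i j. continuous_on (closure G) (a i j)"
    and "continuous_on (closure G \<times> UNIV \<times> UNIV) (\<lambda>(z, w, \<xi>). f z w \<xi>)"
    and "uniformly_parabolic G a"
    and "H1 G a f X Uad" and "H2 G f"
    and "1 \<le> p"
  shows "(\<forall>x0\<in>X. \<forall>u\<in>Uad x0. \<exists>!x. ibvp_solution G a f x0 u x) \<and>
     (admissible_family G a f X Uad \<longrightarrow>
        monotone_control_system X (Lp_norm G p) (state_le G)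
          (C0 (frontier G)) (sup_norm (frontier G))
          (input_space G) (input_norm G) (input_le G)
          (C0 (frontier G)) Uad (solution_map G a f)) \<and>
     (H3 G X \<longrightarrow>
        (\<exists>\<rho> \<eta> \<xi>. linear \<rho> \<and> class_Kinf \<rho> \<and> linear \<eta> \<and> class_Kinf \<eta> \<and> linear \<xi> \<and> class_Kinf \<xi> \<and>
          (\<forall>x\<^sub>m\<in>X. \<forall>x\<in>X. \<forall>x\<^sub>p\<in>X. state_le G x\<^sub>m x \<and> state_le G x x\<^sub>p \<longrightarrow>
             Lp_norm G p x \<le> \<rho> (Lp_norm G p x\<^sub>m + Lp_norm G p x\<^sub>p)) \<and>
          (\<forall>x\<in>X. \<forall>u\<in>Uad x. \<forall>\<epsilon>>0. \<exists>x\<^sub>m\<in>X. \<exists>x\<^sub>p\<in>X.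
             \<exists>u\<^sub>m \<in> Uad x\<^sub>m \<inter> const_inputs G. \<exists>u\<^sub>p \<in> Uad x\<^sub>p \<inter> const_inputs G.
               state_le G x\<^sub>m x \<and> state_le G x x\<^sub>p \<and> input_le G u\<^sub>m u \<and> input_le G u u\<^sub>p \<and>
               max (input_norm G u\<^sub>m) (input_norm G u\<^sub>p) \<le> \<eta> (input_norm G u + \<epsilon>) \<and>
               max (Lp_norm G p x\<^sub>m) (Lp_norm G p x\<^sub>p) \<le> \<xi> (Lp_norm G p x + input_norm G u + \<epsilon>))))"
proof -
  interpret parabolic_problem G a f X Uad
    by standard (use assms in auto)
  interpret X: normed_linear_space X "Lp_norm G p"
    using assms(9) by (rule normed_linear_space_X)
  let ?C = "1 + Lp_norm G p (restr0 (closure G) (\<lambda>_. 1))"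
  have "restr0 (closure G) (\<lambda>_. 1) \<in> X"
    using H1 unfolding H1_def by blast
  then have C: "?C > 0" using X.nrm_nonneg by (simp add: add_pos_nonneg)
  have scale: "linear (\<lambda>r. c * r) \<and> class_Kinf (\<lambda>r. c * r)" if "c > 0" for c :: real
    using class_Kinf_scale[OF that] by (auto intro!: linearI simp: algebra_simps)
  show ?thesis
  proof (intro conjI impI)
    show "\<forall>x0\<in>X. \<forall>u\<in>Uad x0. \<exists>!x. ibvp_solution G a f x0 u x"
      using solution_ex1 by blast
  next
    assume "admissible_family G a f X Uad"
    then show "monotone_control_system X (Lp_norm G p) (state_le G)
          (C0 (frontier G)) (sup_norm (frontier G))
          (input_space G) (input_norm G) (input_le G)
          (C0 (frontier G)) Uad (solution_map G a f)"
      by (rule monotone_control_system_ibvp[OF assms(9)])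
  next
    assume H3: "H3 G X"
    show "\<exists>\<rho> \<eta> \<xi>. linear \<rho> \<and> class_Kinf \<rho> \<and> linear \<eta> \<and> class_Kinf \<eta> \<and> linear \<xi> \<and> class_Kinf \<xi> \<and>
          (\<forall>x\<^sub>m\<in>X. \<forall>x\<in>X. \<forall>x\<^sub>p\<in>X. state_le G x\<^sub>m x \<and> state_le G x x\<^sub>p \<longrightarrow>
             Lp_norm G p x \<le> \<rho> (Lp_norm G p x\<^sub>m + Lp_norm G p x\<^sub>p)) \<and>
          (\<forall>x\<in>X. \<forall>u\<in>Uad x. \<forall>\<epsilon>>0. \<exists>x\<^sub>m\<in>X. \<exists>x\<^sub>p\<in>X.
             \<exists>u\<^sub>m \<in> Uad x\<^sub>m \<inter> const_inputs G. \<exists>u\<^sub>p \<in> Uad x\<^sub>p \<inter> const_inputs G.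
               state_le G x\<^sub>m x \<and> state_le G x x\<^sub>p \<and> input_le G u\<^sub>m u \<and> input_le G u u\<^sub>p \<and>
               max (input_norm G u\<^sub>m) (input_norm G u\<^sub>p) \<le> \<eta> (input_norm G u + \<epsilon>) \<and>
               max (Lp_norm G p x\<^sub>m) (Lp_norm G p x\<^sub>p) \<le> \<xi> (Lp_norm G p x + input_norm G u + \<epsilon>))"
    proof (rule exI[of _ "\<lambda>r. 1 * r"], rule exI[of _ "\<lambda>r. 1 * r"], rule exI[of _ "\<lambda>r. ?C * r"],
        intro conjI ballI allI impI)
      fix x u and \<epsilon> :: real assume "x \<in> X" "u \<in> Uad x" "\<epsilon> > 0"
      from constant_input_bracket[OF H3 assms(9) this]
      show "\<exists>x\<^sub>m\<in>X. \<exists>x\<^sub>p\<in>X. \<exists>u\<^sub>m \<in> Uad x\<^sub>m \<inter> const_inputs G. \<exists>u\<^sub>p \<in> Uad x\<^sub>p \<inter> const_inputs G.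
               state_le G x\<^sub>m x \<and> state_le G x x\<^sub>p \<and> input_le G u\<^sub>m u \<and> input_le G u u\<^sub>p \<and>
               max (input_norm G u\<^sub>m) (input_norm G u\<^sub>p) \<le> 1 * (input_norm G u + \<epsilon>) \<and>
               max (Lp_norm G p x\<^sub>m) (Lp_norm G p x\<^sub>p) \<le> ?C * (Lp_norm G p x + input_norm G u + \<epsilon>)"
        unfolding mult_1 .
    next
      fix x\<^sub>m x x\<^sub>p assume "x\<^sub>m \<in> X" "x \<in> X" "x\<^sub>p \<in> X" "state_le G x\<^sub>m x \<and> state_le G x x\<^sub>p"
      then show "Lp_norm G p x \<le> 1 * (Lp_norm G p x\<^sub>m + Lp_norm G p x\<^sub>p)"
        using Lp_norm_order_bounds[OF assms(9)] by simp
    qed (use scale[of 1] scale[OF C] in auto)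
  qed
qed

end
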